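(* The real periods and the real logarithmic periods of connected graphs are minor monotone: for every connected graph $G$ and every (non-empty, connected) minor $\gamma$ of $G$, $$\mathfrak P(\gamma)\subseteq\mathfrak P(G)\quad\text{and}\quad\mathfrak P^{\log}(\gamma)\subseteq\mathfrak P^{\log}(G).$$
   Context: Graphs are finite undirected multigraphs $G=(V_G,E_G)$, $e_G=|E_G|$. A minor of $G$ is a graph obtained from $G$ by deleting and contracting edges; by convention contracting a set of edges containing a cycle gives the empty graph (with graph polynomial $0$). The graph polynomial is $\Psi_G=\sum_T\prod_{e\notin T}\alpha_e$ (sum over spanning trees $T$ of $G$), in variables $\alpha_e$, $e\in E_G$. For an edge $e_0$, write $H$ for the hyperplane $\alpha_{e_0}=1$, and $\int_{\Delta_H}F\,\delta(H)\prod_{e}d\alpha_e:=\int_{[0,\infty]^{e_G-1}}F|_{\alpha_{e_0}=1}\prod_{e\neq e_0}d\alpha_e$. $\mathfrak P(G)$ (real periods) is the $\mathbb Q$-vector subspace of $\mathbb R$ spanned by the numbers $\int_{\Delta_H}\frac{P}{\Psi_G^{n}}\,\delta(H)\prod_{e}d\alpha_e$, with $n\in\mathbb N$ and $P\in\mathbb Q[\alpha_e,e\in E_G]$ such that the integral converges absolutely. $\mathfrak P^{\log}(G)$ (real logarithmic periods) is the $\mathbb Q$-vector subspace of $\mathbb R$ spanned by the coefficients in the Taylor expansion at $\varepsilon=0$ of all absolutely convergent integrals $\int_{\Delta_H}\frac{P}{\Psi_G^{n}}\Big(\frac{\prod_{e}\alpha_e^{n_e\varepsilon}}{\Psi_G^{m\varepsilon}}\Big)\delta(H)\prod_{e}d\alpha_e$,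 with $m,n\in\mathbb N$, $n_e\in\mathbb Z$ and $P\in\mathbb Q[\alpha_e,e\in E_G]$.
   Formalization: G is also assumed nonseparable (not two non-empty edge sets meeting in at most one vertex): for a connected separable G, e.g. a two-edge path, both period spaces are {0}, while a one-edge minor has periods Q, so the claim as worded fails. *)

theory Defs
  imports
    "HOL-Analysis.Analysis"
    "HOL-Library.Uprod"
    "HOL-Library.Poly_Mapping"
begin

section \<open>Undirected multigraphs and minors\<close>

text \<open>An edge has an unordered pair of endpoints; \<open>Upair u u\<close> is a self-loop.\<close>

record ('v, 'e) mgraph =
  verts :: "'v set"
  edges :: "'e set"
  ends :: "'e \<Rightarrow> 'v uprod"

definition multigraph :: "('v, 'e) mgraph \<Rightarrow> bool" where
  "multigraph G \<longleftrightarrow> finite (verts G) \<and> finite (edges G) \<and>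
     (\<forall>e\<in>edges G. set_uprod (ends G e) \<subseteq> verts G)"

definition adj :: "('v, 'e) mgraph \<Rightarrow> 'e set \<Rightarrow> ('v \<times> 'v) set" where
  "adj G T = {(u, v). \<exists>e\<in>T. ends G e = Upair u v}"

text \<open>Connectedness of the spanning subgraph with edge set \<open>T\<close>. It holds trivially if there
  are no vertices, so non-emptiness is always demanded separately.\<close>

definition connected_by :: "('v, 'e) mgraph \<Rightarrow> 'e set \<Rightarrow> bool" where
  "connected_by G T \<longleftrightarrow> (\<forall>u\<in>verts G. \<forall>v\<in>verts G. (u, v) \<in> (adj G T)\<^sup>*)"

definition connected_graph :: "('v, 'e) mgraph \<Rightarrow> bool" where
  "connected_graph G \<longleftrightarrow> connected_by G (edges G)"

text \<open>Cycles of length 1 (self-loops) and 2 (pairs of parallel edges) are included.\<close>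

definition is_cycle :: "('v, 'e) mgraph \<Rightarrow> 'v list \<Rightarrow> 'e list \<Rightarrow> bool" where
  "is_cycle G vs es \<longleftrightarrow>
     es \<noteq> [] \<and> length vs = length es \<and> distinct vs \<and> distinct es \<and>
     (\<forall>i<length es. ends G (es ! i) = Upair (vs ! i) (vs ! (Suc i mod length es)))"

definition contains_cycle :: "('v, 'e) mgraph \<Rightarrow> 'e set \<Rightarrow> bool" where
  "contains_cycle G C \<longleftrightarrow> (\<exists>vs es. is_cycle G vs es \<and> set es \<subseteq> C)"

definition delete_edges :: "('v, 'e) mgraph \<Rightarrow> 'e set \<Rightarrow> ('v, 'e) mgraph" where
  "delete_edges G D = G\<lparr>edges := edges G - D\<rparr>"

text \<open>The vertices of \<open>G / C\<close> are the connected components of the spanning subgraph with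
  edge set \<open>C\<close>. By convention \<open>G / C\<close> is the empty graph if \<open>C\<close> contains a cycle.\<close>

definition component :: "('v, 'e) mgraph \<Rightarrow> 'e set \<Rightarrow> 'v \<Rightarrow> 'v set" where
  "component G C v = {w. (v, w) \<in> (adj G C)\<^sup>*}"

definition contract_edges :: "('v, 'e) mgraph \<Rightarrow> 'e set \<Rightarrow> ('v set, 'e) mgraph" where
  "contract_edges G C =
     \<lparr>verts = (if contains_cycle G C then {} else component G C ` verts G),
      edges = (if contains_cycle G C then {} else edges G - C),
      ends = (\<lambda>e. map_uprod (component G C) (ends G e))\<rparr>"

text \<open>Deletions and contractions of distinct edges commute, so a minor is determined by
  the set of deleted and the set of contracted edges.\<close>

definition is_minor :: "('v set, 'e) mgraph \<Rightarrow> ('v, 'e) mgraph \<Rightarrow> bool" where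
  "is_minor \<gamma> G \<longleftrightarrow> (\<exists>D C. D \<subseteq> edges G \<and> C \<subseteq> edges G \<and> D \<inter> C = {} \<and>
     \<gamma> = contract_edges (delete_edges G D) C)"

text \<open>A connected graph is nonseparable if its edge set is not the disjoint union of two
  non-empty parts that meet in at most one vertex; equivalently, its cycle matroid is connected.
  Graphs with at most one edge are nonseparable.\<close>

definition incident_verts :: "('v, 'e) mgraph \<Rightarrow> 'e set \<Rightarrow> 'v set" where
  "incident_verts G A = (\<Union>e\<in>A. set_uprod (ends G e))"

definition nonseparable :: "('v, 'e) mgraph \<Rightarrow> bool" where
  "nonseparable G \<longleftrightarrow> (\<forall>A. A \<subset> edges G \<and> A \<noteq> {} \<longrightarrow>
     2 \<le> card (incident_verts G A \<inter> incident_verts G (edges G - A)))"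

section \<open>The graph polynomial\<close>

definition spanning_trees :: "('v, 'e) mgraph \<Rightarrow> 'e set set" where
  "spanning_trees G = {T. T \<subseteq> edges G \<and> verts G \<noteq> {} \<and> connected_by G T \<and> \<not> contains_cycle G T}"

definition graph_poly :: "('v, 'e) mgraph \<Rightarrow> ('e \<Rightarrow> real) \<Rightarrow> real" where
  "graph_poly G \<alpha> = (\<Sum>T\<in>spanning_trees G. \<Prod>e\<in>edges G - T. \<alpha> e)"

section \<open>Rational polynomials in the edge variables\<close>

text \<open>A polynomial is a finitely supported map from monomials (finitely supported exponent
  vectors) to coefficients.\<close>

type_synonym 'e rat_mpoly = "('e \<Rightarrow>\<^sub>0 nat) \<Rightarrow>\<^sub>0 rat"

definition mpoly_vars :: "'e rat_mpoly \<Rightarrow> 'e set" where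
  "mpoly_vars P = (\<Union>m\<in>Poly_Mapping.keys P. Poly_Mapping.keys m)"

definition mpoly_eval :: "'e rat_mpoly \<Rightarrow> ('e \<Rightarrow> real) \<Rightarrow> real" where
  "mpoly_eval P \<alpha> = (\<Sum>m\<in>Poly_Mapping.keys P. of_rat (Poly_Mapping.lookup P m) *
     (\<Prod>e\<in>Poly_Mapping.keys m. \<alpha> e ^ Poly_Mapping.lookup m e))"

section \<open>Integrals on the hyperplane where one edge variable is 1\<close>

text \<open>A point of the domain assigns a value to every edge other than \<open>e0\<close>; the integrand is
  evaluated after setting the variable of \<open>e0\<close> to 1. If \<open>e0\<close> is the only edge, the domain is a
  point of mass 1. The points with some coordinate 0 or infinite form a null set.\<close>

definition orthant :: "('v, 'e) mgraph \<Rightarrow> 'e \<Rightarrow> ('e \<Rightarrow> real) set" where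
  "orthant G e0 = (\<Pi>\<^sub>E e\<in>edges G - {e0}. {0..})"

definition abs_convergent :: "('v, 'e) mgraph \<Rightarrow> 'e \<Rightarrow> (('e \<Rightarrow> real) \<Rightarrow> real) \<Rightarrow> bool" where
  "abs_convergent G e0 F \<longleftrightarrow>
     set_integrable (\<Pi>\<^sub>M e\<in>edges G - {e0}. lborel) (orthant G e0) (\<lambda>\<alpha>. F (\<alpha>(e0 := 1)))"

definition graph_integral :: "('v, 'e) mgraph \<Rightarrow> 'e \<Rightarrow> (('e \<Rightarrow> real) \<Rightarrow> real) \<Rightarrow> real" where
  "graph_integral G e0 F =
     set_lebesgue_integral (\<Pi>\<^sub>M e\<in>edges G - {e0}. lborel) (orthant G e0) (\<lambda>\<alpha>. F (\<alpha>(e0 := 1)))"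

section \<open>Real periods and real logarithmic periods\<close>

global_interpretation rat_real: vector_space "\<lambda>(q::rat) (x::real). of_rat q * x"
  by unfold_locales (simp_all add: algebra_simps of_rat_add of_rat_mult)

text \<open>All choices of the edge \<open>e0\<close> are allowed.\<close>

definition real_periods :: "('v, 'e) mgraph \<Rightarrow> real set" where
  "real_periods G = rat_real.span
     {graph_integral G e0 (\<lambda>\<alpha>. mpoly_eval P \<alpha> / graph_poly G \<alpha> ^ n) | e0 n P.
        e0 \<in> edges G \<and> mpoly_vars P \<subseteq> edges G \<and>
        abs_convergent G e0 (\<lambda>\<alpha>. mpoly_eval P \<alpha> / graph_poly G \<alpha> ^ n)}"

definition log_integrand ::
    "('v, 'e) mgraph \<Rightarrow> 'e rat_mpoly \<Rightarrow> nat \<Rightarrow> nat \<Rightarrow> ('e \<Rightarrow> int) \<Rightarrow> real \<Rightarrow> ('e \<Rightarrow> real) \<Rightarrow> real" where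
  "log_integrand G P n m ne \<epsilon> \<alpha> =
     mpoly_eval P \<alpha> / graph_poly G \<alpha> ^ n *
     ((\<Prod>e\<in>edges G. \<alpha> e powr (of_int (ne e) * \<epsilon>)) / graph_poly G \<alpha> powr (of_nat m * \<epsilon>))"

text \<open>The integral has to converge absolutely for all \<open>\<epsilon>\<close> near 0, and its Taylor expansion is the
  power series that represents it near 0.\<close>

definition real_log_periods :: "('v, 'e) mgraph \<Rightarrow> real set" where
  "real_log_periods G = rat_real.span
     {fps_nth S k | S k e0 n m ne P.
        e0 \<in> edges G \<and> mpoly_vars P \<subseteq> edges G \<and>
        (\<forall>\<^sub>F \<epsilon> in nhds 0. abs_convergent G e0 (log_integrand G P n m ne \<epsilon>)) \<and>
        (\<lambda>\<epsilon>. graph_integral G e0 (log_integrand G P n m ne \<epsilon>)) has_fps_expansion S}"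

text \<open>Minor monotonicity of these spaces needs \<open>nonseparable G\<close>, not just \<open>connected_graph G\<close>.
  Let \<open>G\<close> be connected but separable: a path with two edges, a cycle with a bridge attached, two
  cycles sharing one vertex, a self-loop together with another edge. Then the graph polynomial is a
  product of polynomials in the variables of the two parts of a separation. Scaling the variables
  of one part shows that an absolutely convergent integral has integrand 0, so
  \<open>real_periods G = {0}\<close>. But \<open>G\<close> has a connected minor with a single edge, and the real periods of
  that minor are all rationals.\<close>

end

theory Submission
  imports Defs "HOL-Real_Asymp.Real_Asymp"
begin

text \<open>With \<open>a = \<Psi>\<^bsub>G/e\<^esub>\<close> and \<open>b = \<Psi>\<^bsub>G - e\<^esub>\<close> one has \<open>\<Psi>\<^bsub>G\<^esub> = a + \<alpha>\<^sub>e b\<close>. If neither \<open>a\<close> nor \<open>b\<close>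
  vanishes, integrating a suitable rational function of \<open>\<alpha>\<^sub>e\<close> with denominator \<open>\<Psi>\<^bsub>G\<^esub>\<^sup>s\<^sup>+\<^sup>1\<close> over
  \<open>(0, \<infinity>)\<close> gives \<open>b\<^sup>-\<^sup>s / s\<close> or \<open>a\<^sup>-\<^sup>s / s\<close>, so periods of \<open>G - e\<close> and of \<open>G/e\<close> are periods of \<open>G\<close>. In
  the logarithmic case \<open>s = n + 1 + m \<epsilon>\<close>, and the factor \<open>1/s\<close> is removed on the level of power series.

  It remains to climb from \<open>\<gamma>\<close> to \<open>G\<close> one edge at a time without meeting a bridge or a loop, which would
  make \<open>a\<close> or \<open>b\<close> vanish. If no edge outside \<open>F = E\<^sub>\<gamma>\<close> can be added, then every contracted edge is
  a bridge of \<open>F \<union> C\<close> and every deleted edge lies in the closure of the set \<open>C\<close> of contracted edges, so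
  \<open>F\<close> is a separator of the cycle matroid, contradicting nonseparability.\<close>

section \<open>Spanning trees of minors\<close>

lemma sym_adj: "sym (adj G T)"
proof (rule symI)
  fix u v assume "(u, v) \<in> adj G T"
  moreover have "Upair u v = Upair v u" by simp
  ultimately show "(v, u) \<in> adj G T" unfolding adj_def by auto
qed

lemma rtrancl_adj_sym: "(a, b) \<in> (adj G T)\<^sup>* \<Longrightarrow> (b, a) \<in> (adj G T)\<^sup>*"
  by (rule symD[OF sym_rtrancl[OF sym_adj]])

lemma adj_mono: "S \<subseteq> T \<Longrightarrow> adj G S \<subseteq> adj G T"
  by (auto simp: adj_def)

lemma ends_adj: "e \<in> T \<Longrightarrow> ends G e = Upair a b \<Longrightarrow> (a, b) \<in> adj G T"
  by (auto simp: adj_def)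

lemma uprod_obtain: obtains a b where "p = Upair a b"
  by (metis uprod_exhaust)

lemma multigraph_ends:
  assumes "multigraph G" "e \<in> edges G" "ends G e = Upair a b"
  shows "a \<in> verts G" "b \<in> verts G"
proof -
  have "set_uprod (ends G e) \<subseteq> verts G" using assms(1,2) by (simp add: multigraph_def)
  thus "a \<in> verts G" "b \<in> verts G" using assms(3) by simp_all
qed

text \<open>The remaining edges of the cycle lead from one endpoint of \<open>e\<close> round to the
  other; for a self-loop this walk is empty.\<close>

lemma cycle_edge_bypass:
  assumes cyc: "is_cycle G vs es" and e: "e \<in> set es" and ab: "ends G e = Upair a b"
  shows "(a, b) \<in> (adj G (set es - {e}))\<^sup>*"
proof -
  define n where "n = length es"
  let ?R = "adj G (set es - {e})"
  obtain i where i: "i < n" "es ! i = e" using e by (auto simp: in_set_conv_nth n_def)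
  have dist: "distinct es" and n0: "n > 0" using cyc by (auto simp: is_cycle_def n_def)
  have endsj: "ends G (es ! j) = Upair (vs ! j) (vs ! (Suc j mod n))" if "j < n" for j
    using cyc that by (auto simp: is_cycle_def n_def)
  \<comment> \<open>Starting just after position \<open>i\<close>, fewer than \<open>n\<close> steps
    never use the edge at position \<open>i\<close>, which is \<open>e\<close>.\<close>
  have walk: "k < n \<Longrightarrow> (vs ! (Suc i mod n), vs ! ((Suc i + k) mod n)) \<in> ?R\<^sup>*" for k
  proof (induction k)
    case (Suc k)
    let ?j = "(Suc i + k) mod n"
    have "?j \<noteq> i"
    proof
      assume "?j = i"
      hence "(Suc i + k) mod n = i mod n" using i by simp
      hence "n dvd Suc k" using mod_eq_dvd_iff_nat[of i "Suc i + k" n] by simp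
      thus False using Suc.prems by (auto dest: dvd_imp_le)
    qed
    moreover have jn: "?j < n" using n0 by simp
    ultimately have "es ! ?j \<noteq> e" using dist i by (auto simp: n_def nth_eq_iff_index_eq)
    hence "(vs ! ?j, vs ! (Suc ?j mod n)) \<in> ?R"
      using endsj[OF jn] jn by (auto simp: adj_def n_def)
    moreover have "Suc ?j mod n = (Suc i + Suc k) mod n" by (simp add: mod_Suc_eq)
    ultimately show ?case using Suc by (auto intro: rtrancl_into_rtrancl)
  qed simp
  have "(Suc i + (n - 1)) mod n = i" using i n0 by simp
  with walk[of "n - 1"] n0 have w: "(vs ! (Suc i mod n), vs ! i) \<in> ?R\<^sup>*" by simp
  have "Upair a b = Upair (vs ! i) (vs ! (Suc i mod n))" using endsj[OF i(1)] i(2) ab by simp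
  with w rtrancl_adj_sym[OF w] show ?thesis by auto
qed

definition simple_path :: "('v, 'e) mgraph \<Rightarrow> 'v list \<Rightarrow> 'e list \<Rightarrow> bool" where
  "simple_path G vs es \<longleftrightarrow> length vs = Suc (length es) \<and> distinct vs \<and>
     (\<forall>i<length es. ends G (es ! i) = Upair (vs ! i) (vs ! Suc i))"

text \<open>Induction along the walk: if the next vertex already lies on the path, the path is cut
  back to that vertex instead of being prolonged.\<close>

lemma simple_path_exists:
  assumes "(a, b) \<in> (adj G T)\<^sup>*"
  shows "\<exists>vs es. simple_path G vs es \<and> vs ! 0 = a \<and> vs ! length es = b \<and> set es \<subseteq> T"
  using assms
proof induction
  case base
  have "simple_path G [a] []" by (simp add: simple_path_def)
  thus ?case by (intro exI[of _ "[a]"] exI[of _ "[]"]) simp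
next
  case (step b c)
  then obtain vs es where p: "simple_path G vs es" "vs ! 0 = a" "vs ! length es = b" "set es \<subseteq> T"
    by blast
  from step obtain e where e: "e \<in> T" "ends G e = Upair b c" by (auto simp: adj_def)
  show ?case
  proof (cases "c \<in> set vs")
    case True
    then obtain k where k: "k \<le> length es" "vs ! k = c"
      using p by (metis in_set_conv_nth less_Suc_eq_le simple_path_def)
    have "simple_path G (take (Suc k) vs) (take k es)"
      using p k by (auto simp: simple_path_def)
    thus ?thesis using k p
      by (intro exI[of _ "take (Suc k) vs"] exI[of _ "take k es"]) (auto dest: in_set_takeD)
  next
    case False
    have "simple_path G (vs @ [c]) (es @ [e])"
      using p e False by (auto simp: simple_path_def nth_append less_Suc_eq)
    thus ?thesis using p e
      by (intro exI[of _ "vs @ [c]"] exI[of _ "es @ [e]"]) (auto simp: nth_append simple_path_def)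
  qed
qed

text \<open>A simple path between the endpoints of \<open>e\<close> is closed by \<open>e\<close>;
  for \<open>a = b\<close> the path has no edges and the cycle is the self-loop
  \<open>e\<close>.\<close>

lemma path_closes_cycle:
  assumes ab: "(a, b) \<in> (adj G T)\<^sup>*" and e: "e \<notin> T" "ends G e = Upair a b"
  shows "contains_cycle G (insert e T)"
proof -
  obtain vs es where p: "simple_path G vs es" "vs ! 0 = a" "vs ! length es = b" "set es \<subseteq> T"
    using simple_path_exists[OF ab] by blast
  \<comment> \<open>Equal edges have equal unordered pairs of endpoints, and on a path with distinct
    vertices this forces equal positions.\<close>
  have "i = j" if "i < length es" "j < length es" "es ! i = es ! j" for i j
  proof -
    have "Upair (vs ! i) (vs ! Suc i) = Upair (vs ! j) (vs ! Suc j)"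
      using that p by (metis simple_path_def)
    thus ?thesis using that p by (auto simp: simple_path_def nth_eq_iff_index_eq)
  qed
  hence "distinct es" by (auto simp: distinct_conv_nth)
  moreover have "ends G ((es @ [e]) ! i) = Upair (vs ! i) (vs ! (Suc i mod Suc (length es)))"
    if "i \<le> length es" for i
  proof (cases "i = length es")
    case False
    thus ?thesis using that p by (simp add: simple_path_def nth_append)
  qed (use p e in simp)
  ultimately have "is_cycle G vs (es @ [e])"
    using p e by (auto simp: is_cycle_def simple_path_def less_Suc_eq_le)
  thus ?thesis using p unfolding contains_cycle_def
    by (intro exI[of _ vs] exI[of _ "es @ [e]"]) auto
qed

lemma connected_by_mono: "connected_by G S \<Longrightarrow> S \<subseteq> T \<Longrightarrow> connected_by G T"
  unfolding connected_by_def using rtrancl_mono[OF adj_mono] by blast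

lemma connected_by_remove:
  assumes "connected_by G T" "ends G e = Upair a b" "(a, b) \<in> (adj G (T - {e}))\<^sup>*"
  shows "connected_by G (T - {e})"
proof -
  have "adj G T \<subseteq> (adj G (T - {e}))\<^sup>*"
  proof
    fix p assume "p \<in> adj G T"
    then obtain e' u v where e': "p = (u, v)" "e' \<in> T" "ends G e' = Upair u v"
      by (auto simp: adj_def)
    show "p \<in> (adj G (T - {e}))\<^sup>*"
    proof (cases "e' = e")
      case True
      thus ?thesis using e' assms rtrancl_adj_sym[OF assms(3)] by auto
    next
      case False
      thus ?thesis using e' by (auto simp: adj_def)
    qed
  qed
  hence "(adj G T)\<^sup>* \<subseteq> (adj G (T - {e}))\<^sup>*" by (rule rtrancl_subset_rtrancl)
  thus ?thesis using assms(1) by (auto simp: connected_by_def)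
qed

lemma cycle_remove_edge:
  assumes "is_cycle G vs es" "e \<in> set es" "set es \<subseteq> T" "connected_by G T"
  shows "connected_by G (T - {e})"
proof -
  obtain a b where ab: "ends G e = Upair a b" by (rule uprod_obtain)
  have "(a, b) \<in> (adj G (T - {e}))\<^sup>*"
    using cycle_edge_bypass[OF assms(1,2) ab] rtrancl_mono[OF adj_mono[of "set es - {e}" "T - {e}" G]] assms(3)
    by blast
  thus ?thesis using connected_by_remove assms ab by metis
qed

lemma redundant_edge_cycle:
  assumes "multigraph G" "e \<in> edges G" "e \<in> T" "connected_by G (T - {e})"
  shows "contains_cycle G T"
proof -
  obtain a b where ab: "ends G e = Upair a b" by (rule uprod_obtain)
  have "(a, b) \<in> (adj G (T - {e}))\<^sup>*"
    using assms multigraph_ends[OF assms(1,2) ab] by (auto simp: connected_by_def)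
  from path_closes_cycle[OF this _ ab] show ?thesis using assms(3) by (simp add: insert_absorb)
qed

text \<open>Cycles of \<open>J\<close> are broken one at a time. Since \<open>I\<close> is acyclic,
  every cycle has an edge outside \<open>I\<close>, and that edge is dropped.\<close>

lemma spanning_tree_between:
  assumes "finite J" "I \<subseteq> J" "connected_by G J" "\<not> contains_cycle G I"
  shows "\<exists>T. I \<subseteq> T \<and> T \<subseteq> J \<and> connected_by G T \<and> \<not> contains_cycle G T"
  using assms
proof (induction J rule: finite_psubset_induct)
  case (psubset J)
  show ?case
  proof (cases "contains_cycle G J")
    case True
    then obtain vs es where c: "is_cycle G vs es" "set es \<subseteq> J" by (auto simp: contains_cycle_def)
    with psubset.prems obtain e where e: "e \<in> set es" "e \<notin> I" by (fastforce simp: contains_cycle_def)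
    have "connected_by G (J - {e})" using cycle_remove_edge c e psubset.prems by metis
    moreover have "J - {e} \<subset> J" "I \<subseteq> J - {e}" using e c psubset.prems by auto
    ultimately obtain T where "I \<subseteq> T" "T \<subseteq> J - {e}" "connected_by G T" "\<not> contains_cycle G T"
      using psubset.IH psubset.prems by meson
    thus ?thesis by blast
  qed (use psubset.prems in blast)
qed

section \<open>Spanning trees of a minor, seen inside the graph\<close>

text \<open>For \<open>C\<close> disjoint from \<open>F\<close>, these are the spanning trees of the
  minor with edge set \<open>F\<close> in which \<open>C\<close> is contracted and every other edge
  is deleted. Since they are described inside \<open>G\<close>, passing between minors does not
  change the vertex type.\<close>

definition minor_trees :: "('v, 'e) mgraph \<Rightarrow> 'e set \<Rightarrow> 'e set \<Rightarrow> 'e set set" where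
  "minor_trees G C F = {T. T \<subseteq> F \<and> T \<union> C \<in> spanning_trees G}"

lemma minor_trees_nonempty:
  assumes "finite F" "finite C" "verts G \<noteq> {}" "F \<union> C \<subseteq> edges G"
    and "connected_by G (F \<union> C)" "\<not> contains_cycle G C"
  shows "minor_trees G C F \<noteq> {}"
proof -
  obtain T where T: "C \<subseteq> T" "T \<subseteq> F \<union> C" "connected_by G T" "\<not> contains_cycle G T"
    using spanning_tree_between[of "F \<union> C" C G] assms by auto
  have "(T \<inter> F) \<union> C = T" using T by blast
  hence "T \<inter> F \<in> minor_trees G C F" using T assms by (auto simp: minor_trees_def spanning_trees_def)
  thus ?thesis by blast
qed

section \<open>Exchange of an edge in a nonseparable graph\<close>

lemma contains_cycle_mono: "contains_cycle G S \<Longrightarrow> S \<subseteq> T \<Longrightarrow> contains_cycle G T"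
  unfolding contains_cycle_def by blast

text \<open>The walk is cut at its last visit to \<open>u\<close>.\<close>

lemma rtrancl_leave_start:
  assumes "(u, y) \<in> R\<^sup>*" "u \<noteq> y"
  shows "\<exists>x. (u, x) \<in> R \<and> x \<noteq> u \<and> (x, y) \<in> (R \<inter> (- {u}) \<times> (- {u}))\<^sup>*"
  using assms
proof induction
  case (step y z)
  show ?case
  proof (cases "u = y")
    case True
    thus ?thesis using step by blast
  next
    case False
    then obtain x where "(u, x) \<in> R" "x \<noteq> u" "(x, y) \<in> (R \<inter> (- {u}) \<times> (- {u}))\<^sup>*"
      using step by blast
    moreover have "(y, z) \<in> R \<inter> (- {u}) \<times> (- {u})" using False step by auto
    ultimately show ?thesis by (meson rtrancl_into_rtrancl)
  qed
qed simp

text \<open>A loop on its own would be one part of a separation, since it meets the other edges at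
  most in its single vertex.\<close>

lemma nonseparable_no_loop:
  assumes "nonseparable G" "e \<in> edges G" "edges G \<noteq> {e}" "ends G e = Upair a b"
  shows "a \<noteq> b"
proof
  assume "a = b"
  have "{e} \<subset> edges G" using assms by auto
  hence "2 \<le> card (incident_verts G {e} \<inter> incident_verts G (edges G - {e}))"
    using assms unfolding nonseparable_def by blast
  moreover have "incident_verts G {e} = {a}" using assms \<open>a = b\<close> by (simp add: incident_verts_def)
  ultimately show False
    by (metis card.empty card_1_singleton_iff inf_le1 not_numeral_le_zero numeral_le_one_iff semiring_norm(69) subset_singletonD One_nat_def)
qed

text \<open>Otherwise any vertex \<open>u\<close> incident both to \<open>F\<close> and to its complement is a cut vertex.\<close>

lemma nonseparable_exchange:
  assumes nonsep: "nonseparable G" and F: "F \<subset> edges G" "F \<noteq> {}" and C: "C \<subseteq> edges G - F"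
  shows "(\<exists>c\<in>C. \<exists>p q. ends G c = Upair p q \<and> (p, q) \<in> (adj G (F \<union> C - {c}))\<^sup>*) \<or>
    (\<exists>d\<in>edges G - F - C. \<exists>p q. ends G d = Upair p q \<and> (p, q) \<notin> (adj G C)\<^sup>*)"
proof (rule ccontr)
  assume "\<not> ?thesis"
  hence bridge: "\<And>c p q. c \<in> C \<Longrightarrow> ends G c = Upair p q \<Longrightarrow> (p, q) \<notin> (adj G (F \<union> C - {c}))\<^sup>*"
    and clos: "\<And>d p q. d \<in> edges G - F - C \<Longrightarrow> ends G d = Upair p q \<Longrightarrow> (p, q) \<in> (adj G C)\<^sup>*"
    by blast+
  have "2 \<le> card (incident_verts G F \<inter> incident_verts G (edges G - F))"
    using nonsep F by (simp add: nonseparable_def)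
  hence "incident_verts G F \<inter> incident_verts G (edges G - F) \<noteq> {}" by force
  then obtain u f a where u: "f \<in> F" "a \<in> edges G - F"
    "u \<in> set_uprod (ends G f)" "u \<in> set_uprod (ends G a)"
    by (auto simp: incident_verts_def)
  have obt: "\<exists>y. ends G e = Upair u y" if "u \<in> set_uprod (ends G e)" for e u
    using that by (cases "ends G e") (auto intro: exI)
  \<comment> \<open>The edges of \<open>F\<close> at \<open>u\<close> are removed, so that
    \<open>u\<close> can be left within \<open>H\<close> only along \<open>C\<close>. The component
    \<open>Z\<close> of \<open>u\<close> in \<open>H\<close> will be cut off from the rest at
    \<open>u\<close>.\<close>
  define H where "H = F \<union> C - {f \<in> F. u \<in> set_uprod (ends G f)}"
  define Z where "Z = {v. (u, v) \<in> (adj G H)\<^sup>*}"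
  have CH: "C \<subseteq> H" using C by (auto simp: H_def)
  \<comment> \<open>\<open>Z\<close> is closed under all edges except the removed ones: an edge
    outside \<open>F\<close> and \<open>C\<close> joins vertices that are already connected by
    \<open>C\<close>, hence within \<open>H\<close>.\<close>
  have cl: "w' \<in> Z" if "e \<in> edges G - (F - H)" "ends G e = Upair w w'" "w \<in> Z" for e w w'
  proof -
    have "(w, w') \<in> (adj G H)\<^sup>*"
    proof (cases "e \<in> H")
      case True
      thus ?thesis using that ends_adj by (metis r_into_rtrancl)
    next
      case False
      hence "(w, w') \<in> (adj G C)\<^sup>*" using that clos CH by blast
      thus ?thesis using rtrancl_mono[OF adj_mono[OF CH]] by blast
    qed
    thus ?thesis using that(3) unfolding Z_def by (auto intro: rtrancl_trans)
  qed
  \<comment> \<open>Otherwise a walk in \<open>H\<close> from \<open>u\<close> to \<open>y\<close>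
    leaves \<open>u\<close> for the last time along some \<open>c \<in> C\<close> and then avoids
    \<open>u\<close>, hence \<open>c\<close>. Together with \<open>g\<close> it joins the endpoints
    of \<open>c\<close>, so \<open>c\<close> would not be a bridge.\<close>
  have out: "y \<notin> Z" if g: "g \<in> F" "ends G g = Upair u y" for g y
  proof
    assume "y \<in> Z"
    have "u \<noteq> y" using nonseparable_no_loop[OF nonsep _ _ g(2)] g(1) F
      by (metis insert_absorb psubsetE psubset_insert_iff singleton_insert_inj_eq' subsetD subset_singletonD)
    then obtain x where x: "(u, x) \<in> adj G H" "x \<noteq> u"
      "(x, y) \<in> (adj G H \<inter> (- {u}) \<times> (- {u}))\<^sup>*"
      using rtrancl_leave_start \<open>y \<in> Z\<close> by (metis Z_def mem_Collect_eq)
    then obtain c where c: "c \<in> H" "ends G c = Upair u x" by (auto simp: adj_def)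
    hence "c \<in> C" by (auto simp: H_def)
    have "adj G H \<inter> (- {u}) \<times> (- {u}) \<subseteq> adj G (F \<union> C - {c})"
      using c by (auto simp: adj_def H_def)
    with x(3) have "(x, y) \<in> (adj G (F \<union> C - {c}))\<^sup>*" using rtrancl_mono by blast
    moreover have "g \<in> F \<union> C - {c}" using g \<open>c \<in> C\<close> C by auto
    hence "(u, y) \<in> adj G (F \<union> C - {c})" using g(2) by (rule ends_adj)
    ultimately have "(u, x) \<in> (adj G (F \<union> C - {c}))\<^sup>*"
      using rtrancl_adj_sym by (metis converse_rtrancl_into_rtrancl)
    thus False using bridge[OF \<open>c \<in> C\<close> c(2)] by blast
  qed
  \<comment> \<open>The separation is \<open>Q\<close> against the other edges. It is proper because
    of \<open>a\<close> and \<open>f\<close>. An edge outside \<open>Q\<close> that touches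
    \<open>Z\<close> must be a removed edge by \<open>cl\<close>, and by \<open>out\<close> it
    touches \<open>Z\<close> only in \<open>u\<close>.\<close>
  define Q where "Q = {e \<in> edges G. set_uprod (ends G e) \<subseteq> Z}"
  have uZ: "u \<in> Z" by (simp add: Z_def)
  have "a \<in> Q"
  proof -
    obtain y where y: "ends G a = Upair u y" using obt u by blast
    hence "y \<in> Z" using cl[OF _ y uZ] u by blast
    thus ?thesis using y uZ u by (simp add: Q_def)
  qed
  moreover have "f \<notin> Q" using u obt[OF u(3)] out by (auto simp: Q_def)
  ultimately have "Q \<subset> edges G" "Q \<noteq> {}" using u F by (auto simp: Q_def)
  hence "2 \<le> card (incident_verts G Q \<inter> incident_verts G (edges G - Q))"
    using nonsep by (simp add: nonseparable_def)
  moreover have "incident_verts G Q \<inter> incident_verts G (edges G - Q) \<subseteq> {u}"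
  proof
    fix w assume "w \<in> incident_verts G Q \<inter> incident_verts G (edges G - Q)"
    then obtain e where w: "w \<in> Z" "e \<in> edges G" "e \<notin> Q" "w \<in> set_uprod (ends G e)"
      by (auto simp: incident_verts_def Q_def)
    then obtain w' where e: "ends G e = Upair w w'" using obt by blast
    show "w \<in> {u}"
    proof (cases "e \<in> F - H")
      case True
      hence "u \<in> set_uprod (ends G e)" by (auto simp: H_def)
      thus ?thesis using e w(1) out[of e w] True by (auto simp: Upair_inject)
    next
      case False
      hence "w' \<in> Z" using cl[OF _ e w(1)] w by blast
      hence "e \<in> Q" using e w by (simp add: Q_def)
      thus ?thesis using w by simp
    qed
  qed
  ultimately show False
    by (metis card_1_singleton_iff card.empty subset_singletonD not_numeral_le_zero numeral_le_one_iff semiring_norm(69) One_nat_def)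
qed

text \<open>The edge \<open>e\<close> is one that can be added to \<open>F\<close> as neither a
  bridge nor a loop, whatever its present role. A contracted \<open>c\<close> may be deleted because
  the rest stays connected without it; a deleted \<open>d\<close> may be contracted because it
  closes no cycle with \<open>C\<close>.\<close>

lemma minor_trees_exchange:
  assumes G: "multigraph G" "nonseparable G" "verts G \<noteq> {}"
    and F: "F \<subset> edges G" "F \<noteq> {}" and C: "C \<subseteq> edges G - F" and ne: "minor_trees G C F \<noteq> {}"
  shows "\<exists>e\<in>edges G - F. minor_trees G (C - {e}) F \<noteq> {} \<and> minor_trees G (insert e C) F \<noteq> {}"
proof -
  have "finite (edges G)" using G by (simp add: multigraph_def)
  hence fin: "finite F" "finite C" using F C by (meson finite_subset finite_Diff psubset_imp_subset)+
  obtain S where S: "S \<subseteq> F" "connected_by G (S \<union> C)" "\<not> contains_cycle G (S \<union> C)"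
    using ne unfolding minor_trees_def spanning_trees_def by blast
  have conn: "connected_by G (F \<union> C)" by (rule connected_by_mono[OF S(2)]) (use S(1) in blast)
  have acyc: "\<not> contains_cycle G C" using contains_cycle_mono[of G C "S \<union> C"] S(3) by blast
  have sub: "F \<union> C \<subseteq> edges G" using F C by blast
  from nonseparable_exchange[OF G(2) F C] show ?thesis
  proof
    assume "\<exists>c\<in>C. \<exists>p q. ends G c = Upair p q \<and> (p, q) \<in> (adj G (F \<union> C - {c}))\<^sup>*"
    then obtain c p q where c: "c \<in> C" "ends G c = Upair p q" "(p, q) \<in> (adj G (F \<union> C - {c}))\<^sup>*"
      by blast
    have "connected_by G (F \<union> C - {c})" by (rule connected_by_remove[OF conn c(2,3)])
    moreover have "F \<union> C - {c} = F \<union> (C - {c})" using c C by auto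
    ultimately have "minor_trees G (C - {c}) F \<noteq> {}"
      using fin G(3) sub acyc contains_cycle_mono[of G "C - {c}" C]
      by (intro minor_trees_nonempty) auto
    moreover have "minor_trees G (insert c C) F \<noteq> {}" using c(1) ne by (simp add: insert_absorb)
    moreover have "c \<in> edges G - F" using c(1) C by blast
    ultimately show ?thesis by blast
  next
    assume "\<exists>d\<in>edges G - F - C. \<exists>p q. ends G d = Upair p q \<and> (p, q) \<notin> (adj G C)\<^sup>*"
    then obtain d p q where d: "d \<in> edges G - F - C" "ends G d = Upair p q" "(p, q) \<notin> (adj G C)\<^sup>*"
      by blast
    have "\<not> contains_cycle G (insert d C)"
    proof
      assume "contains_cycle G (insert d C)"
      then obtain vs es where c: "is_cycle G vs es" "set es \<subseteq> insert d C"
        by (auto simp: contains_cycle_def)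
      hence "d \<in> set es" using acyc by (auto simp: contains_cycle_def)
      from cycle_edge_bypass[OF c(1) this d(2)] have "(p, q) \<in> (adj G C)\<^sup>*"
        using rtrancl_mono[OF adj_mono[of "set es - {d}" C G]] c by blast
      thus False using d by blast
    qed
    moreover have "connected_by G (F \<union> insert d C)" by (rule connected_by_mono[OF conn]) blast
    ultimately have "minor_trees G (insert d C) F \<noteq> {}"
      using fin G(3) sub d(1) by (intro minor_trees_nonempty) auto
    moreover have "minor_trees G (C - {d}) F \<noteq> {}" using d(1) ne by simp
    moreover have "d \<in> edges G - F" using d(1) by blast
    ultimately show ?thesis by blast
  qed
qed

section \<open>Contraction and spanning trees\<close>

text \<open>A walk in the contraction lifts to \<open>G\<close> by inserting walks along
  \<open>C\<close> inside each component; conversely the steps along \<open>C\<close> collapse to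
  points.\<close>

lemma rtrancl_adj_contract_iff:
  "(component G C u, component G C v) \<in> (adj (contract_edges G C) T)\<^sup>* \<longleftrightarrow>
    (u, v) \<in> (adj G (T \<union> C))\<^sup>*"
proof
  have mono: "(a, b) \<in> (adj G (T \<union> C))\<^sup>*" if "(a, b) \<in> (adj G C)\<^sup>*" for a b
    using that rtrancl_mono[OF adj_mono[of C "T \<union> C" G]] by blast
  assume "(component G C u, component G C v) \<in> (adj (contract_edges G C) T)\<^sup>*"
  \<comment> \<open>Quantifying over the whole component lets the induction continue from whichever
    vertex the next edge starts at.\<close>
  hence "\<forall>w\<in>component G C v. (u, w) \<in> (adj G (T \<union> C))\<^sup>*"
  proof induction
    case base
    thus ?case using mono by (auto simp: component_def)
  next
    case (step Y Z)
    then obtain e where e: "e \<in> T" "map_uprod (component G C) (ends G e) = Upair Y Z"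
      by (auto simp: adj_def contract_edges_def)
    obtain p q where pq: "ends G e = Upair p q" "Y = component G C p" "Z = component G C q"
    proof (cases "ends G e")
      case (Upair p q)
      hence "Upair (component G C p) (component G C q) = Upair Y Z" using e(2) by simp
      moreover have "ends G e = Upair q p" using Upair by (auto simp: Upair_inject)
      ultimately show ?thesis using that Upair by auto
    qed
    have "(p, q) \<in> adj G (T \<union> C)" using e pq by (auto simp: adj_def)
    moreover have "(u, p) \<in> (adj G (T \<union> C))\<^sup>*" using step.IH pq by (simp add: component_def)
    ultimately show ?case using mono pq by (auto simp: component_def intro: rtrancl_trans rtrancl_into_rtrancl)
  qed
  thus "(u, v) \<in> (adj G (T \<union> C))\<^sup>*" by (auto simp: component_def)
next
  assume "(u, v) \<in> (adj G (T \<union> C))\<^sup>*"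
  thus "(component G C u, component G C v) \<in> (adj (contract_edges G C) T)\<^sup>*"
  proof induction
    case (step v w)
    then obtain e where e: "e \<in> T \<union> C" "ends G e = Upair v w" by (auto simp: adj_def)
    show ?case
    proof (cases "e \<in> C")
      case True
      hence "(v, w) \<in> adj G C" using e by (auto simp: adj_def)
      hence "component G C v = component G C w"
        using rtrancl_adj_sym[of v w G C] by (auto simp: component_def intro: rtrancl_trans converse_rtrancl_into_rtrancl)
      thus ?thesis using step by simp
    next
      case False
      hence "(component G C v, component G C w) \<in> adj (contract_edges G C) T"
        using e by (force simp: adj_def contract_edges_def)
      thus ?thesis using step by simp
    qed
  qed simp
qed

lemma connected_by_contract_iff:
  assumes "\<not> contains_cycle G C"
  shows "connected_by (contract_edges G C) T \<longleftrightarrow> connected_by G (T \<union> C)"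
proof -
  have "verts (contract_edges G C) = component G C ` verts G" using assms by (simp add: contract_edges_def)
  thus ?thesis by (simp add: connected_by_def rtrancl_adj_contract_iff)
qed

lemma multigraph_contract:
  assumes "multigraph G"
  shows "multigraph (contract_edges G C)"
  using assms by (auto simp: multigraph_def contract_edges_def uprod.set_map)

text \<open>Cycles are not transported through the contraction directly. For connected sets, a cycle
  means a droppable edge, and connectedness is carried over by
  \<open>connected_by_contract_iff\<close>.\<close>

lemma spanning_trees_contract:
  assumes G: "multigraph G" and C: "C \<subseteq> edges G" "\<not> contains_cycle G C"
  shows "spanning_trees (contract_edges G C) = minor_trees G C (edges G - C)"
proof -
  let ?H = "contract_edges G C"
  have eH: "edges ?H = edges G - C" using C by (simp add: contract_edges_def)
  have vH: "verts ?H \<noteq> {} \<longleftrightarrow> verts G \<noteq> {}" using C by (simp add: contract_edges_def)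
  have cyc: "contains_cycle ?H T \<longleftrightarrow> contains_cycle G (T \<union> C)"
    if T: "T \<subseteq> edges G - C" and conn: "connected_by G (T \<union> C)" for T
  proof
    assume "contains_cycle ?H T"
    then obtain vs es where c: "is_cycle ?H vs es" "set es \<subseteq> T" by (auto simp: contains_cycle_def)
    then obtain e where e: "e \<in> set es" by (cases es) (auto simp: is_cycle_def)
    have "connected_by ?H (T - {e})"
      using cycle_remove_edge[OF c(1) e c(2)] conn connected_by_contract_iff[OF C(2)] by blast
    hence "connected_by G (T - {e} \<union> C)" using connected_by_contract_iff[OF C(2)] by blast
    moreover have "T - {e} \<union> C = T \<union> C - {e}" using e c T by auto
    ultimately show "contains_cycle G (T \<union> C)"
      using redundant_edge_cycle[OF G, of e "T \<union> C"] e c T by auto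
  next
    assume "contains_cycle G (T \<union> C)"
    then obtain vs es where c: "is_cycle G vs es" "set es \<subseteq> T \<union> C" by (auto simp: contains_cycle_def)
    \<comment> \<open>The dropped edge must survive the contraction; the cycle has such an edge
      because \<open>C\<close> is acyclic.\<close>
    with C obtain e where e: "e \<in> set es" "e \<notin> C" by (fastforce simp: contains_cycle_def)
    have "connected_by G (T \<union> C - {e})" using cycle_remove_edge[OF c(1) e(1) c(2) conn] .
    moreover have "T - {e} \<union> C = T \<union> C - {e}" using e by auto
    ultimately have "connected_by ?H (T - {e})" using connected_by_contract_iff[OF C(2)] by metis
    thus "contains_cycle ?H T"
      using redundant_edge_cycle[OF multigraph_contract[OF G], of e C T] e c T eH by auto
  qed
  show ?thesis
    using C cyc by (auto simp: spanning_trees_def minor_trees_def eH vH connected_by_contract_iff)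
qed

text \<open>As the minor has a vertex, the convention for contracting a cycle did not apply, so
  \<open>C\<close> is acyclic. Connectedness of the minor then provides a spanning tree.\<close>

lemma is_minor_trees:
  assumes G: "multigraph G" and m: "is_minor \<gamma> G" and \<gamma>: "verts \<gamma> \<noteq> {}" "connected_graph \<gamma>"
  shows "verts G \<noteq> {}" and "\<exists>C. C \<subseteq> edges G - edges \<gamma> \<and> edges \<gamma> \<subseteq> edges G \<and>
    spanning_trees \<gamma> = minor_trees G C (edges \<gamma>) \<and> minor_trees G C (edges \<gamma>) \<noteq> {}"
proof -
  obtain D C where DC: "D \<subseteq> edges G" "C \<subseteq> edges G" "D \<inter> C = {}"
    and \<gamma>_def: "\<gamma> = contract_edges (delete_edges G D) C"
    using m by (auto simp: is_minor_def)
  let ?K = "delete_edges G D"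
  have K: "multigraph ?K" using G by (auto simp: multigraph_def delete_edges_def)
  have ac: "\<not> contains_cycle ?K C" using \<gamma> by (auto simp: \<gamma>_def contract_edges_def split: if_splits)
  have e\<gamma>: "edges \<gamma> = edges G - D - C" using ac by (auto simp: \<gamma>_def contract_edges_def delete_edges_def)
  have CK: "C \<subseteq> edges ?K" using DC by (auto simp: delete_edges_def)
  have st: "spanning_trees \<gamma> = minor_trees ?K C (edges \<gamma>)"
    using spanning_trees_contract[OF K CK ac] e\<gamma> by (simp add: \<gamma>_def delete_edges_def)
  have conn: "connected_by ?K (edges \<gamma> \<union> C)"
    using \<gamma> connected_by_contract_iff[OF ac] by (simp add: connected_graph_def \<gamma>_def)
  have adjK: "adj ?K = adj G" and cycK: "contains_cycle ?K = contains_cycle G"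
    and vK: "verts ?K = verts G"
    by (simp_all add: adj_def delete_edges_def fun_eq_iff contains_cycle_def is_cycle_def)
  have cK: "connected_by ?K = connected_by G" by (simp add: connected_by_def adjK vK fun_eq_iff)
  show vG: "verts G \<noteq> {}" using \<gamma> by (auto simp: \<gamma>_def contract_edges_def delete_edges_def split: if_splits)
  have "minor_trees ?K C (edges \<gamma>) = minor_trees G C (edges \<gamma>)"
  proof -
    have "edges ?K = edges G - D" by (simp add: delete_edges_def)
    thus ?thesis using DC unfolding minor_trees_def spanning_trees_def cycK vK cK e\<gamma> by auto
  qed
  moreover have "minor_trees G C (edges \<gamma>) \<noteq> {}"
    using minor_trees_nonempty[of "edges \<gamma>" C G] G DC vG conn ac cK cycK e\<gamma>
    by (auto simp: multigraph_def intro: finite_subset)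
  ultimately show "\<exists>C. C \<subseteq> edges G - edges \<gamma> \<and> edges \<gamma> \<subseteq> edges G \<and>
    spanning_trees \<gamma> = minor_trees G C (edges \<gamma>) \<and> minor_trees G C (edges \<gamma>) \<noteq> {}"
    using st DC e\<gamma> by (intro exI[of _ C]) auto
qed

section \<open>Rational polynomial functions\<close>

lemma mpoly_eval_superset:
  assumes "finite S" "Poly_Mapping.keys P \<subseteq> S"
  shows "mpoly_eval P \<alpha> = (\<Sum>m\<in>S. of_rat (Poly_Mapping.lookup P m) *
     (\<Prod>e\<in>Poly_Mapping.keys m. \<alpha> e ^ Poly_Mapping.lookup m e))"
  unfolding mpoly_eval_def
  by (rule sum.mono_neutral_left) (use assms in \<open>auto simp: in_keys_iff\<close>)

lemma mpoly_eval_add: "mpoly_eval (P + Q) \<alpha> = mpoly_eval P \<alpha> + mpoly_eval Q \<alpha>"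
proof -
  let ?S = "Poly_Mapping.keys P \<union> Poly_Mapping.keys Q"
  have "Poly_Mapping.keys (P + Q) \<subseteq> ?S" by (rule keys_add)
  thus ?thesis
    by (simp add: mpoly_eval_superset[of ?S] lookup_add of_rat_add distrib_right sum.distrib)
qed

lemma mpoly_eval_0: "mpoly_eval 0 \<alpha> = 0"
  by (simp add: mpoly_eval_def)

lemma mpoly_eval_sum: "mpoly_eval (sum f A) \<alpha> = (\<Sum>a\<in>A. mpoly_eval (f a) \<alpha>)"
  by (induction A rule: infinite_finite_induct) (simp_all add: mpoly_eval_0 mpoly_eval_add)

lemma mpoly_eval_single:
  "mpoly_eval (Poly_Mapping.single m c) \<alpha> =
    of_rat c * (\<Prod>e\<in>Poly_Mapping.keys m. \<alpha> e ^ Poly_Mapping.lookup m e)"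
  by (simp add: mpoly_eval_superset[of "{m}"])

lemma monomial_value_add:
  fixes \<alpha> :: "'e \<Rightarrow> real"
  shows "(\<Prod>e\<in>Poly_Mapping.keys (m + k). \<alpha> e ^ Poly_Mapping.lookup (m + k) e) =
    (\<Prod>e\<in>Poly_Mapping.keys m. \<alpha> e ^ Poly_Mapping.lookup m e) *
    (\<Prod>e\<in>Poly_Mapping.keys k. \<alpha> e ^ Poly_Mapping.lookup k e)"
proof -
  let ?S = "Poly_Mapping.keys m \<union> Poly_Mapping.keys k"
  have ext: "(\<Prod>e\<in>Poly_Mapping.keys j. \<alpha> e ^ Poly_Mapping.lookup j e) =
      (\<Prod>e\<in>?S. \<alpha> e ^ Poly_Mapping.lookup j e)" if "Poly_Mapping.keys j \<subseteq> ?S" for j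
    by (rule prod.mono_neutral_left) (use that in \<open>auto simp: in_keys_iff\<close>)
  show ?thesis
    using ext[of m] ext[of k] ext[OF keys_add[of m k]]
    by (simp add: lookup_add power_add prod.distrib)
qed

lemma poly_mapping_eq_sum_single:
  "(\<Sum>m\<in>Poly_Mapping.keys P. Poly_Mapping.single m (Poly_Mapping.lookup P m)) = P"
proof (rule poly_mapping_eqI)
  fix m
  have "Poly_Mapping.lookup (\<Sum>k\<in>Poly_Mapping.keys P. Poly_Mapping.single k (Poly_Mapping.lookup P k)) m =
      (\<Sum>k\<in>Poly_Mapping.keys P. if k = m then Poly_Mapping.lookup P k else 0)"
    by (simp add: lookup_sum lookup_single when_def)
  also have "\<dots> = Poly_Mapping.lookup P m" by (simp add: in_keys_iff)
  finally show "Poly_Mapping.lookup (\<Sum>k\<in>Poly_Mapping.keys P. Poly_Mapping.single k (Poly_Mapping.lookup P k)) m =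
    Poly_Mapping.lookup P m" .
qed

lemma mpoly_eval_mult: "mpoly_eval (P * Q) \<alpha> = mpoly_eval P \<alpha> * mpoly_eval Q \<alpha>"
proof -
  let ?s = Poly_Mapping.single and ?l = Poly_Mapping.lookup and ?k = Poly_Mapping.keys
  have "P * Q = (\<Sum>a\<in>?k P. \<Sum>b\<in>?k Q. ?s (a + b) (?l P a * ?l Q b))"
    by (subst (1) poly_mapping_eq_sum_single[symmetric, of P],
        subst (1) poly_mapping_eq_sum_single[symmetric, of Q])
       (simp add: sum_product mult_single)
  thus ?thesis
    by (simp add: mpoly_eval_sum mpoly_eval_single monomial_value_add of_rat_mult)
       (simp add: mpoly_eval_def sum_product mult_ac)
qed

text \<open>Working with functions allows graph polynomials and numerators to be combined freely; a
  formal polynomial is chosen only when a period has to be exhibited.\<close>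

definition rat_poly_funs :: "'e set \<Rightarrow> (('e \<Rightarrow> real) \<Rightarrow> real) set" where
  "rat_poly_funs E = {mpoly_eval P | P. mpoly_vars P \<subseteq> E}"

lemma rat_poly_funs_add:
  assumes "f \<in> rat_poly_funs E" "g \<in> rat_poly_funs E"
  shows "(\<lambda>\<alpha>. f \<alpha> + g \<alpha>) \<in> rat_poly_funs E"
proof -
  obtain P Q where "f = mpoly_eval P" "mpoly_vars P \<subseteq> E" "g = mpoly_eval Q" "mpoly_vars Q \<subseteq> E"
    using assms by (auto simp: rat_poly_funs_def)
  moreover from this have "mpoly_vars (P + Q) \<subseteq> E"
    using keys_add[of P Q] unfolding mpoly_vars_def by blast
  ultimately show ?thesis
    by (auto simp: rat_poly_funs_def mpoly_eval_add fun_eq_iff intro!: exI[of _ "P + Q"])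
qed

lemma rat_poly_funs_mult:
  assumes "f \<in> rat_poly_funs E" "g \<in> rat_poly_funs E"
  shows "(\<lambda>\<alpha>. f \<alpha> * g \<alpha>) \<in> rat_poly_funs E"
proof -
  obtain P Q where PQ: "f = mpoly_eval P" "mpoly_vars P \<subseteq> E" "g = mpoly_eval Q" "mpoly_vars Q \<subseteq> E"
    using assms by (auto simp: rat_poly_funs_def)
  have "mpoly_vars (P * Q) \<subseteq> E"
  proof
    fix e assume "e \<in> mpoly_vars (P * Q)"
    then obtain m where "m \<in> Poly_Mapping.keys (P * Q)" "e \<in> Poly_Mapping.keys m"
      by (auto simp: mpoly_vars_def)
    then obtain a b where "a \<in> Poly_Mapping.keys P" "b \<in> Poly_Mapping.keys Q" "e \<in> Poly_Mapping.keys (a + b)"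
      using keys_mult[of P Q] by blast
    thus "e \<in> E" using keys_add[of a b] PQ unfolding mpoly_vars_def by blast
  qed
  thus ?thesis using PQ
    by (auto simp: rat_poly_funs_def mpoly_eval_mult fun_eq_iff intro!: exI[of _ "P * Q"])
qed

lemma rat_poly_funs_const: "(\<lambda>\<alpha>. of_rat c) \<in> rat_poly_funs E"
  unfolding rat_poly_funs_def
  by (rule CollectI, rule exI[of _ "Poly_Mapping.single 0 c"])
     (auto simp: mpoly_eval_single mpoly_vars_def fun_eq_iff split: if_splits)

lemma rat_poly_funs_var: "e \<in> E \<Longrightarrow> (\<lambda>\<alpha>. \<alpha> e) \<in> rat_poly_funs E"
  unfolding rat_poly_funs_def
  by (rule CollectI, rule exI[of _ "Poly_Mapping.single (Poly_Mapping.single e 1) 1"])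
     (auto simp: mpoly_eval_single mpoly_vars_def fun_eq_iff)

lemma rat_poly_funs_power: "f \<in> rat_poly_funs E \<Longrightarrow> (\<lambda>\<alpha>. f \<alpha> ^ k) \<in> rat_poly_funs E"
  by (induction k) (use rat_poly_funs_const[of 1] rat_poly_funs_mult in auto)

lemma rat_poly_funs_prod:
  "(\<And>i. i \<in> I \<Longrightarrow> f i \<in> rat_poly_funs E) \<Longrightarrow> (\<lambda>\<alpha>. \<Prod>i\<in>I. f i \<alpha>) \<in> rat_poly_funs E"
  by (induction I rule: infinite_finite_induct)
     (use rat_poly_funs_const[of 1] in \<open>auto intro: rat_poly_funs_mult\<close>)

lemma rat_poly_funs_sum:
  "(\<And>i. i \<in> I \<Longrightarrow> f i \<in> rat_poly_funs E) \<Longrightarrow> (\<lambda>\<alpha>. \<Sum>i\<in>I. f i \<alpha>) \<in> rat_poly_funs E"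
  by (induction I rule: infinite_finite_induct)
     (use rat_poly_funs_const[of 0] in \<open>auto intro: rat_poly_funs_add\<close>)

lemma rat_poly_funs_mono: "E \<subseteq> F \<Longrightarrow> rat_poly_funs E \<subseteq> rat_poly_funs F"
  unfolding rat_poly_funs_def by blast

lemma mpoly_eval_cong:
  assumes "mpoly_vars P \<subseteq> E" "\<And>i. i \<in> E \<Longrightarrow> \<alpha> i = \<beta> i"
  shows "mpoly_eval P \<alpha> = mpoly_eval P \<beta>"
  unfolding mpoly_eval_def
  by (intro sum.cong prod.cong refl arg_cong2[where f = "(*)"]) (use assms in \<open>auto simp: mpoly_vars_def\<close>)

lemma rat_poly_funs_cong:
  "f \<in> rat_poly_funs E \<Longrightarrow> (\<And>i. i \<in> E \<Longrightarrow> \<alpha> i = \<beta> i) \<Longrightarrow> f \<alpha> = f \<beta>"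
  unfolding rat_poly_funs_def using mpoly_eval_cong by blast

section \<open>Deletion and contraction for the graph polynomial\<close>

text \<open>If \<open>B\<close> consists of the spanning trees of a graph with edge set
  \<open>E\<close>, this is its graph polynomial. Vertices disappear from the analytic part of the
  argument.\<close>

definition basis_poly :: "'e set \<Rightarrow> 'e set set \<Rightarrow> ('e \<Rightarrow> real) \<Rightarrow> real" where
  "basis_poly E B \<alpha> = (\<Sum>T\<in>B. \<Prod>e\<in>E - T. \<alpha> e)"

definition delete_basis :: "'e \<Rightarrow> 'e set set \<Rightarrow> 'e set set" where
  "delete_basis e B = {T \<in> B. e \<notin> T}"

definition contract_basis :: "'e \<Rightarrow> 'e set set \<Rightarrow> 'e set set" where
  "contract_basis e B = {T. e \<notin> T \<and> insert e T \<in> B}"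

lemma basis_poly_rat: "basis_poly E B \<in> rat_poly_funs E"
  unfolding basis_poly_def[abs_def]
  by (intro rat_poly_funs_sum rat_poly_funs_prod rat_poly_funs_var) auto

text \<open>A set avoiding \<open>e\<close> contributes the factor \<open>\<alpha> e\<close>, a set
  containing \<open>e\<close> does not.\<close>

lemma basis_poly_insert:
  assumes E: "finite E" "e \<notin> E" and B: "B \<subseteq> Pow (insert e E)"
  shows "basis_poly (insert e E) B \<alpha> =
    basis_poly E (contract_basis e B) \<alpha> + \<alpha> e * basis_poly E (delete_basis e B) \<alpha>"
proof -
  have fin: "finite B" using finite_subset[OF B] E by simp
  have split: "B = delete_basis e B \<union> insert e ` contract_basis e B"
  proof -
    have "T \<in> insert e ` contract_basis e B" if "T \<in> B" "e \<in> T" for T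
      using that by (intro image_eqI[of _ _ "T - {e}"]) (auto simp: contract_basis_def insert_absorb)
    thus ?thesis by (auto simp: delete_basis_def contract_basis_def)
  qed
  have fin2: "finite (delete_basis e B)" "finite (insert e ` contract_basis e B)"
    using fin split by (metis finite_Un)+
  have inj: "inj_on (insert e) (contract_basis e B)"
    by (auto simp: inj_on_def contract_basis_def)
  have "basis_poly (insert e E) B \<alpha> = (\<Sum>T\<in>delete_basis e B. \<Prod>f\<in>insert e E - T. \<alpha> f) +
      (\<Sum>T\<in>insert e ` contract_basis e B. \<Prod>f\<in>insert e E - T. \<alpha> f)"
    unfolding basis_poly_def
    by (subst (1) split, rule sum.union_disjoint) (use fin2 in \<open>auto simp: delete_basis_def\<close>)
  also have "(\<Sum>T\<in>delete_basis e B. \<Prod>f\<in>insert e E - T. \<alpha> f) = \<alpha> e * basis_poly E (delete_basis e B) \<alpha>"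
    unfolding basis_poly_def sum_distrib_left
    by (rule sum.cong) (use E in \<open>auto simp: delete_basis_def insert_Diff_if\<close>)
  also have "(\<Sum>T\<in>insert e ` contract_basis e B. \<Prod>f\<in>insert e E - T. \<alpha> f) = basis_poly E (contract_basis e B) \<alpha>"
    unfolding basis_poly_def
    by (subst sum.reindex[OF inj]) (use E in \<open>auto intro!: sum.cong prod.cong\<close>)
  finally show ?thesis by simp
qed

lemma basis_poly_pos:
  assumes "finite B" "B \<noteq> {}" "\<And>i. i \<in> E \<Longrightarrow> 0 < \<alpha> i"
  shows "0 < basis_poly E B \<alpha>"
  unfolding basis_poly_def by (rule sum_pos) (use assms in \<open>auto intro!: prod_pos\<close>)

section \<open>Integrating out one edge variable\<close>

text \<open>The kernel is the derivative of \<open>(y b / (a + y b))\<^sup>s / s\<close> if \<open>\<sigma> = 1\<close>, and of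
  \<open>- (a / (a + y b))\<^sup>s / s\<close> if \<open>\<sigma> = 0\<close>.\<close>

lemma kernel_integral:
  fixes a b s :: real
  assumes a: "a > 0" and b: "b > 0" and s: "s > 0"
  shows "has_bochner_integral lborel (\<lambda>y. indicator {0<..} y *
    (y powr (of_bool \<sigma> * (s - 1)) * a * b * (if \<sigma> then b else a) powr (s - 1) / (a + y * b) powr (s + 1))) (1 / s)"
proof -
  define f where "f = (\<lambda>y. y powr (of_bool \<sigma> * (s - 1)) * a * b * (if \<sigma> then b else a) powr (s - 1) / (a + y * b) powr (s + 1))"
  define F where "F = (\<lambda>y. if \<sigma> then (y * b / (a + y * b)) powr s / s else - ((a / (a + y * b)) powr s / s))"
  have pos: "a + y * b > 0" if "y > 0" for y using that a b by (simp add: add_pos_pos)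
  have nz: "a + y * b \<noteq> 0" if "y > 0" for y using pos[OF that] by simp
  have deriv: "DERIV F y :> f y" if y: "y > 0" for y
  proof (cases \<sigma>)
    case True
    have "((\<lambda>y. (y * b / (a + y * b)) powr s / s) has_real_derivative
       s * (y * b / (a + y * b)) powr (s - 1) * ((b * (a + y * b) - y * b * b) / (a + y * b)\<^sup>2) / s) (at y)"
      using y b pos[OF y] by (auto intro!: derivative_eq_intros simp: power2_eq_square)
    also have "b * (a + y * b) - y * b * b = a * b" by (simp add: algebra_simps)
    also have "s * (y * b / (a + y * b)) powr (s - 1) * (a * b / (a + y * b)\<^sup>2) / s = f y"
      unfolding f_def using True s y b pos[OF y]
      by (simp add: powr_divide powr_mult powr_add powr_diff power2_eq_square mult_ac)
    finally show ?thesis using True by (simp add: F_def)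
  next
    case False
    have "((\<lambda>y. - ((a / (a + y * b)) powr s / s)) has_real_derivative
       - (s * (a / (a + y * b)) powr (s - 1) * (- (a * b) / (a + y * b)\<^sup>2) / s)) (at y)"
      using y a pos[OF y] by (auto intro!: derivative_eq_intros simp: power2_eq_square)
    also have "- (s * (a / (a + y * b)) powr (s - 1) * (- (a * b) / (a + y * b)\<^sup>2) / s) = f y"
      using False s y a pos[OF y]
      by (simp add: f_def powr_divide powr_mult powr_add powr_diff power2_eq_square mult_ac)
    finally show ?thesis using False by (simp add: F_def)
  qed
  have cont: "isCont f y" if "y > 0" for y
    unfolding f_def using that pos[OF that] by (intro continuous_intros) auto
  have nonneg: "f y \<ge> 0" for y using a b by (auto simp: f_def)
  \<comment> \<open>In both cases the limits at \<open>0\<close> and at infinity differ by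
    \<open>1 / s\<close>.\<close>
  have lim0: "(F \<longlongrightarrow> (if \<sigma> then 0 else - 1 / s)) (at_right 0)"
  proof (cases \<sigma>)
    case True
    have "((\<lambda>y. y * b / (a + y * b)) \<longlongrightarrow> 0 * b / (a + 0 * b)) (at_right 0)"
      using a by (intro tendsto_intros) auto
    \<comment> \<open>The base tends to \<open>0\<close>, where the limit of \<open>powr\<close>
      requires an eventually non-negative base and a positive exponent.\<close>
    moreover have "\<forall>\<^sub>F y in at_right 0. 0 \<le> y * b / (a + y * b)"
      using a b by (intro eventually_at_rightI[of 0 1]) auto
    ultimately have "((\<lambda>y. (y * b / (a + y * b)) powr s) \<longlongrightarrow> 0 powr s) (at_right 0)"
      using s by (intro tendsto_powr') auto
    from tendsto_divide[OF this tendsto_const[of s]] show ?thesis using True s by (simp add: F_def)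
  next
    case False
    have "((\<lambda>y. - ((a / (a + y * b)) powr s / s)) \<longlongrightarrow> - ((a / (a + 0 * b)) powr s / s)) (at_right 0)"
      using a s by (intro tendsto_intros) auto
    thus ?thesis using False a by (simp add: F_def)
  qed
  have limoo: "(F \<longlongrightarrow> (if \<sigma> then 1 / s else 0)) at_top"
  proof (cases \<sigma>)
    case True
    have "((\<lambda>y. y * b / (a + y * b)) \<longlongrightarrow> 1) at_top" using a b by real_asymp
    hence "((\<lambda>y. (y * b / (a + y * b)) powr s) \<longlongrightarrow> 1 powr s) at_top"
      by (intro tendsto_powr) auto
    from tendsto_divide[OF this tendsto_const[of s]] show ?thesis using True s by (simp add: F_def)
  next
    case False
    have "((\<lambda>y. a / (a + y * b)) \<longlongrightarrow> 0) at_top" using a b by real_asymp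
    moreover have "\<forall>\<^sub>F y in at_top. 0 \<le> a / (a + y * b)"
      using a b by (intro eventually_mono[OF eventually_gt_at_top[of 0]]) auto
    ultimately have "((\<lambda>y. (a / (a + y * b)) powr s) \<longlongrightarrow> 0 powr s) at_top"
      using s by (intro tendsto_powr') auto
    from tendsto_minus[OF tendsto_divide[OF this tendsto_const[of s]]] show ?thesis
      using False s by (simp add: F_def)
  qed
  have ei: "einterval 0 \<infinity> = {0::real<..}" by (auto simp: einterval_def)
  have lim0': "((F \<circ> real_of_ereal) \<longlongrightarrow> (if \<sigma> then 0 else - 1 / s)) (at_right 0)"
    using lim0 by (simp add: zero_ereal_def ereal_tendsto_simps)
  have limoo': "((F \<circ> real_of_ereal) \<longlongrightarrow> (if \<sigma> then 1 / s else 0)) (at_left \<infinity>)"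
    using limoo by (simp add: ereal_tendsto_simps)
  have int: "set_integrable lborel {0<..} f" "(LBINT y=0..\<infinity>. f y) = 1 / s"
    using interval_integral_FTC_nonneg[of 0 \<infinity> F f, OF _ _ _ _ lim0' limoo'] deriv cont nonneg
    by (auto simp: ei split: if_splits)
  hence "(LINT y:{0<..}|lborel. f y) = 1 / s"
    by (simp add: interval_lebesgue_integral_def ei)
  thus ?thesis using int(1) unfolding set_integrable_def set_lebesgue_integral_def f_def[symmetric]
    by (simp add: has_bochner_integral_iff f_def)
qed

text \<open>Each coordinate hyperplane is a box with one side of measure 0. Integrands then need to
  be compared only where no variable vanishes.\<close>

lemma AE_PiM_lborel_nonzero:
  assumes "finite I"
  shows "AE x in (\<Pi>\<^sub>M i\<in>I. lborel). \<forall>i\<in>I. x i \<noteq> (0::real)"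
proof -
  interpret product_sigma_finite "\<lambda>_. lborel :: real measure" by standard
  have "AE x in (\<Pi>\<^sub>M i\<in>I. lborel). x i \<noteq> (0::real)" if i: "i \<in> I" for i
  proof (rule AE_I)
    let ?N = "\<Pi>\<^sub>E j\<in>I. if j = i then {0::real} else UNIV"
    show "{x \<in> space (\<Pi>\<^sub>M i\<in>I. lborel). \<not> x i \<noteq> (0::real)} \<subseteq> ?N"
      by (auto simp: space_PiM PiE_def Pi_def)
    have "emeasure (\<Pi>\<^sub>M i\<in>I. lborel) ?N = (\<Prod>j\<in>I. emeasure lborel (if j = i then {0::real} else UNIV))"
      using assms by (intro emeasure_PiM) auto
    also have "\<dots> = 0"
      by (rule prod_zero[OF assms]) (use i in \<open>auto intro!: bexI[of _ i]\<close>)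
    finally show "emeasure (\<Pi>\<^sub>M i\<in>I. lborel) ?N = 0" .
    show "?N \<in> sets (\<Pi>\<^sub>M i\<in>I. lborel)" using assms by (intro sets_PiM_I_finite) auto
  qed
  thus ?thesis using assms by (simp add: AE_finite_all)
qed

text \<open>The kernel \<open>k\<close> may depend on \<open>x\<close>, but its integral
  \<open>c\<close> may not. As \<open>k\<close> is non-negative, the norm of a section integrates to
  \<open>norm (g x) * c\<close>, so Tonelli gives integrability and Fubini the value.\<close>

lemma lborel_product_kernel:
  fixes f g :: "('i \<Rightarrow> real) \<Rightarrow> real"
  assumes I: "finite I" "i \<notin> I"
    and f: "f \<in> borel_measurable (\<Pi>\<^sub>M i\<in>insert i I. lborel)"
    and g: "integrable (\<Pi>\<^sub>M i\<in>I. lborel) g"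
    and k: "AE x in (\<Pi>\<^sub>M i\<in>I. lborel). \<exists>k. (AE y in lborel. f (x(i := y)) = g x * k y) \<and>
      (\<forall>y. 0 \<le> k y) \<and> has_bochner_integral lborel k c"
  shows "integrable (\<Pi>\<^sub>M i\<in>insert i I. lborel) f"
    and "integral\<^sup>L (\<Pi>\<^sub>M i\<in>insert i I. lborel) f = c * integral\<^sup>L (\<Pi>\<^sub>M i\<in>I. lborel) g"
proof -
  interpret product_sigma_finite "\<lambda>_. lborel :: real measure" by standard
  have sect: "AE x in (\<Pi>\<^sub>M i\<in>I. lborel). (\<integral>\<^sup>+ y. norm (f (x(i := y))) \<partial>lborel) = ennreal (norm (g x) * c)
      \<and> (\<integral>y. f (x(i := y)) \<partial>lborel) = g x * c"
    using k AE_space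
  proof eventually_elim
    case (elim x)
    then obtain k where k: "AE y in lborel. f (x(i := y)) = g x * k y" "\<And>y. 0 \<le> k y"
      "has_bochner_integral lborel k c" by blast
    have [measurable]: "(\<lambda>y. f (x(i := y))) \<in> borel_measurable lborel"
      using measurable_comp[OF measurable_component_update f, of x] elim I unfolding comp_def by blast
    have [measurable]: "k \<in> borel_measurable lborel" using k(3) by (auto simp: has_bochner_integral_iff)
    have "(\<integral>\<^sup>+ y. norm (f (x(i := y))) \<partial>lborel) = (\<integral>\<^sup>+ y. ennreal (norm (g x)) * ennreal (k y) \<partial>lborel)"
    proof (rule nn_integral_cong_AE)
      show "AE y in lborel. ennreal (norm (f (x(i := y)))) = ennreal (norm (g x)) * ennreal (k y)"
        using k(1) by eventually_elim (simp add: abs_mult k(2) ennreal_mult)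
    qed
    also have "\<dots> = ennreal (norm (g x)) * ennreal c"
      using k(2,3) by (simp add: nn_integral_cmult nn_integral_eq_integral[of lborel k] has_bochner_integral_iff)
    also have "\<dots> = ennreal (norm (g x) * c)"
      using k(2) has_bochner_integral_integral_eq[OF k(3)] Bochner_Integration.integral_nonneg[of lborel k]
      by (simp add: ennreal_mult)
    finally have 1: "(\<integral>\<^sup>+ y. norm (f (x(i := y))) \<partial>lborel) = ennreal (norm (g x) * c)" .
    have "(\<integral>y. f (x(i := y)) \<partial>lborel) = (\<integral>y. g x * k y \<partial>lborel)"
      by (rule integral_cong_AE) (use k(1) in auto)
    also have "\<dots> = g x * c" using has_bochner_integral_integral_eq[OF k(3)] by simp
    finally show ?case using 1 by blast
  qed
  have nf: "(\<lambda>x. ennreal (norm (f x))) \<in> borel_measurable (\<Pi>\<^sub>M i\<in>insert i I. lborel)"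
    using f by measurable
  have "(\<integral>\<^sup>+ x. norm (f x) \<partial>(\<Pi>\<^sub>M i\<in>insert i I. lborel)) =
      (\<integral>\<^sup>+ x. \<integral>\<^sup>+ y. norm (f (x(i := y))) \<partial>lborel \<partial>(\<Pi>\<^sub>M i\<in>I. lborel))"
    by (rule product_nn_integral_insert[OF I nf])
  also have "\<dots> = (\<integral>\<^sup>+ x. ennreal (norm (g x) * c) \<partial>(\<Pi>\<^sub>M i\<in>I. lborel))"
    by (rule nn_integral_cong_AE) (use sect in auto)
  also have "\<dots> \<le> (\<integral>\<^sup>+ x. ennreal (norm (norm (g x) * c)) \<partial>(\<Pi>\<^sub>M i\<in>I. lborel))"
    by (intro nn_integral_mono ennreal_leI) simp
  also have "\<dots> < \<infinity>"
  proof -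
    have "integrable (\<Pi>\<^sub>M i\<in>I. lborel) (\<lambda>x. norm (g x) * c)"
      using integrable_norm[OF g] by (rule integrable_mult_left)
    thus ?thesis unfolding integrable_iff_bounded by blast
  qed
  finally show int: "integrable (\<Pi>\<^sub>M i\<in>insert i I. lborel) f"
    using f by (simp add: integrable_iff_bounded)
  have sf: "(\<lambda>x. \<integral>y. f (x(i := y)) \<partial>lborel) \<in> borel_measurable (\<Pi>\<^sub>M i\<in>I. lborel)"
  proof -
    have "(\<lambda>(x, y). f (x(i := y))) \<in> borel_measurable ((\<Pi>\<^sub>M i\<in>I. lborel) \<Otimes>\<^sub>M lborel)"
      using measurable_comp[OF measurable_add_dim f] by (simp add: comp_def split_beta')
    thus ?thesis by (rule lborel.borel_measurable_lebesgue_integral)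
  qed
  have "integral\<^sup>L (\<Pi>\<^sub>M i\<in>insert i I. lborel) f = (\<integral>x. (\<integral>y. f (x(i := y)) \<partial>lborel) \<partial>(\<Pi>\<^sub>M i\<in>I. lborel))"
    by (rule product_integral_insert[OF I int])
  also have "\<dots> = (\<integral>x. g x * c \<partial>(\<Pi>\<^sub>M i\<in>I. lborel))"
    by (rule integral_cong_AE) (use sf sect g in auto)
  finally show "integral\<^sup>L (\<Pi>\<^sub>M i\<in>insert i I. lborel) f = c * integral\<^sup>L (\<Pi>\<^sub>M i\<in>I. lborel) g" by simp
qed

text \<open>The counterpart of \<open>abs_convergent\<close> in which only the edge set of the graph
  is kept.\<close>

definition hyper_integrable :: "'e set \<Rightarrow> 'e \<Rightarrow> (('e \<Rightarrow> real) \<Rightarrow> real) \<Rightarrow> bool" where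
  "hyper_integrable E e0 F \<longleftrightarrow>
     set_integrable (\<Pi>\<^sub>M e\<in>E - {e0}. lborel) (\<Pi>\<^sub>E e\<in>E - {e0}. {0..}) (\<lambda>\<alpha>. F (\<alpha>(e0 := 1)))"

definition hyper_integral :: "'e set \<Rightarrow> 'e \<Rightarrow> (('e \<Rightarrow> real) \<Rightarrow> real) \<Rightarrow> real" where
  "hyper_integral E e0 F =
     set_lebesgue_integral (\<Pi>\<^sub>M e\<in>E - {e0}. lborel) (\<Pi>\<^sub>E e\<in>E - {e0}. {0..}) (\<lambda>\<alpha>. F (\<alpha>(e0 := 1)))"

text \<open>The edge \<open>e0\<close> set to \<open>1\<close> lies in \<open>E\<close>, so the new
  variable \<open>e\<close> is always integrated over. The factorization is required only at
  positive points: the others in the orthant form a null set.\<close>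

lemma hyper_integral_kernel:
  assumes E: "finite E" "e0 \<in> E" "e \<notin> E"
    and f: "(\<lambda>\<alpha>. f (\<alpha>(e0 := 1))) \<in> borel_measurable (\<Pi>\<^sub>M i\<in>insert e E - {e0}. lborel)"
    and g: "hyper_integrable E e0 g"
    and k: "\<And>\<alpha>. (\<And>i. i \<in> E \<Longrightarrow> 0 < \<alpha> i) \<Longrightarrow>
      \<exists>k. (\<forall>y>0. f (\<alpha>(e := y)) = g \<alpha> * k y \<and> 0 \<le> k y) \<and>
          has_bochner_integral lborel (\<lambda>y. indicator {0<..} y * k y) c"
  shows "hyper_integrable (insert e E) e0 f" and "hyper_integral (insert e E) e0 f = c * hyper_integral E e0 g"
proof -
  let ?I = "E - {e0}"
  have ins: "insert e E - {e0} = insert e ?I" using E by auto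
  have I: "finite ?I" "e \<notin> ?I" using E by auto
  define f' where "f' = (\<lambda>\<alpha>. indicator (\<Pi>\<^sub>E i\<in>insert e ?I. {0::real..}) \<alpha> *\<^sub>R f (\<alpha>(e0 := 1)))"
  define g' where "g' = (\<lambda>\<alpha>. indicator (\<Pi>\<^sub>E i\<in>?I. {0::real..}) \<alpha> *\<^sub>R g (\<alpha>(e0 := 1)))"
  have "(\<Pi>\<^sub>E i\<in>insert e ?I. {0::real..}) \<in> sets (\<Pi>\<^sub>M i\<in>insert e ?I. lborel)"
    using I by (intro sets_PiM_I_finite) auto
  hence f': "f' \<in> borel_measurable (\<Pi>\<^sub>M i\<in>insert e ?I. lborel)"
    using f unfolding f'_def ins by measurable
  have g': "integrable (\<Pi>\<^sub>M i\<in>?I. lborel) g'"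
    using g unfolding g'_def hyper_integrable_def set_integrable_def .
  have "AE x in (\<Pi>\<^sub>M i\<in>?I. lborel). \<exists>k. (AE y in lborel. f' (x(e := y)) = g' x * k y) \<and>
      (\<forall>y. 0 \<le> k y) \<and> has_bochner_integral lborel k c"
    using AE_PiM_lborel_nonzero[OF I(1)] AE_space
  proof eventually_elim
    case (elim x)
    hence ext: "x \<in> extensional ?I" by (auto simp: space_PiM PiE_def)
    \<comment> \<open>If \<open>x\<close> has a negative coordinate, both integrands vanish. The
      constant point \<open>1\<close> then merely supplies some kernel with integral
      \<open>c\<close>.\<close>
    define \<beta> where "\<beta> = (if \<forall>i\<in>?I. 0 \<le> x i then x(e0 := 1) else (\<lambda>_. 1))"
    have "0 < \<beta> i" if "i \<in> E" for i
      using that elim(1) by (auto simp: \<beta>_def less_le)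
    then obtain k where k: "\<And>y. y > 0 \<Longrightarrow> f (\<beta>(e := y)) = g \<beta> * k y \<and> 0 \<le> k y"
      "has_bochner_integral lborel (\<lambda>y. indicator {0<..} y * k y) c"
      using k[of \<beta>] by blast
    \<comment> \<open>The value \<open>y = 0\<close> is excluded because it belongs to the orthant,
      whereas the kernel is cut off to \<open>y > 0\<close>.\<close>
    have "f' (x(e := y)) = g' x * (indicator {0<..} y * k y)" if y: "y \<noteq> 0" for y
    proof (cases "(\<forall>i\<in>?I. 0 \<le> x i) \<and> y > 0")
      case True
      have "x(e := y) \<in> (\<Pi>\<^sub>E i\<in>insert e ?I. {0..})" "x \<in> (\<Pi>\<^sub>E i\<in>?I. {0..})"
        using True ext by (auto simp: PiE_def extensional_def)
      moreover have "(x(e := y))(e0 := 1) = \<beta>(e := y)" using True E by (auto simp: \<beta>_def fun_eq_iff)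
      ultimately show ?thesis using True k(1)[of y] by (auto simp: f'_def g'_def \<beta>_def)
    next
      case False
      hence "x(e := y) \<notin> (\<Pi>\<^sub>E i\<in>insert e ?I. {0..})"
      proof (cases "y > 0")
        case True
        with False obtain i where "i \<in> ?I" "x i < 0" by force
        moreover have "i \<noteq> e" using \<open>i \<in> ?I\<close> E by auto
        ultimately show ?thesis by (auto simp: PiE_def Pi_def intro!: bexI[of _ i])
      next
        case False
        thus ?thesis using y by (auto simp: PiE_def)
      qed
      moreover have "y > 0 \<Longrightarrow> x \<notin> (\<Pi>\<^sub>E i\<in>?I. {0..})" using False by (auto simp: PiE_def)
      ultimately show ?thesis by (auto simp: f'_def g'_def indicator_def)
    qed
    moreover have "AE y in lborel. y \<noteq> (0::real)" by (rule AE_lborel_singleton)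
    ultimately have "AE y in lborel. f' (x(e := y)) = g' x * (indicator {0<..} y * k y)"
      by (auto elim: eventually_mono)
    moreover have "0 \<le> indicator {0<..} y * k y" for y using k(1)[of y] by (auto simp: indicator_def)
    ultimately show ?case
      using k(2) by (intro exI[of _ "\<lambda>y. indicator {0<..} y * k y"]) blast
  qed
  from lborel_product_kernel[OF I f' g' this]
  show "hyper_integrable (insert e E) e0 f" "hyper_integral (insert e E) e0 f = c * hyper_integral E e0 g"
    by (simp_all add: hyper_integrable_def hyper_integral_def set_integrable_def
        set_lebesgue_integral_def ins f'_def g'_def)
qed

section \<open>Periods of an edge set with a family of trees\<close>

definition basis_periods :: "'e set \<Rightarrow> 'e set set \<Rightarrow> real set" where
  "basis_periods E B = rat_real.span
     {hyper_integral E e0 (\<lambda>\<alpha>. mpoly_eval P \<alpha> / basis_poly E B \<alpha> ^ n) | e0 n P.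
        e0 \<in> E \<and> mpoly_vars P \<subseteq> E \<and>
        hyper_integrable E e0 (\<lambda>\<alpha>. mpoly_eval P \<alpha> / basis_poly E B \<alpha> ^ n)}"

text \<open>Here \<open>p\<close> is a function, so that \<open>numerator p n\<close> can take its
  place.\<close>

definition basis_log_integrand ::
    "'e set \<Rightarrow> 'e set set \<Rightarrow> (('e \<Rightarrow> real) \<Rightarrow> real) \<Rightarrow> nat \<Rightarrow> nat \<Rightarrow> ('e \<Rightarrow> int) \<Rightarrow> real \<Rightarrow> ('e \<Rightarrow> real) \<Rightarrow> real" where
  "basis_log_integrand E B p n m ne \<epsilon> \<alpha> =
     p \<alpha> / basis_poly E B \<alpha> ^ n *
     ((\<Prod>e\<in>E. \<alpha> e powr (of_int (ne e) * \<epsilon>)) / basis_poly E B \<alpha> powr (of_nat m * \<epsilon>))"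

definition basis_log_periods :: "'e set \<Rightarrow> 'e set set \<Rightarrow> real set" where
  "basis_log_periods E B = rat_real.span
     {fps_nth S k | S k e0 n m ne P. e0 \<in> E \<and> mpoly_vars P \<subseteq> E \<and>
        (\<forall>\<^sub>F \<epsilon> in nhds 0. hyper_integrable E e0 (basis_log_integrand E B (mpoly_eval P) n m ne \<epsilon>)) \<and>
        (\<lambda>\<epsilon>. hyper_integral E e0 (basis_log_integrand E B (mpoly_eval P) n m ne \<epsilon>)) has_fps_expansion S}"

lemma coordinate_measurable:
  "i \<in> E \<Longrightarrow> (\<lambda>\<alpha>. (\<alpha>(e0 := 1)) i) \<in> borel_measurable (\<Pi>\<^sub>M i\<in>E - {e0}. lborel)"
  by (cases "i = e0") (auto intro: measurable_component_singleton[of i "E - {e0}" "\<lambda>_. lborel", simplified])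

lemma rat_poly_funs_measurable:
  assumes "p \<in> rat_poly_funs E"
  shows "(\<lambda>\<alpha>. p (\<alpha>(e0 := 1))) \<in> borel_measurable (\<Pi>\<^sub>M i\<in>E - {e0}. lborel)"
proof -
  obtain P where P: "p = mpoly_eval P" "mpoly_vars P \<subseteq> E" using assms by (auto simp: rat_poly_funs_def)
  show ?thesis unfolding P(1) mpoly_eval_def
    by (intro borel_measurable_sum borel_measurable_times borel_measurable_const borel_measurable_prod
        borel_measurable_power coordinate_measurable)
       (use P(2) in \<open>auto simp: mpoly_vars_def\<close>)
qed

lemma basis_log_integrand_measurable:
  assumes "p \<in> rat_poly_funs E"
  shows "(\<lambda>\<alpha>. basis_log_integrand E B p n m ne \<epsilon> (\<alpha>(e0 := 1))) \<in> borel_measurable (\<Pi>\<^sub>M i\<in>E - {e0}. lborel)"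
  unfolding basis_log_integrand_def
  by (intro borel_measurable_times borel_measurable_divide borel_measurable_power borel_measurable_prod
      powr_real_measurable borel_measurable_const coordinate_measurable
      rat_poly_funs_measurable[OF assms] rat_poly_funs_measurable[OF basis_poly_rat])

section \<open>Adding one edge\<close>

text \<open>The assumptions \<open>del\<close> and \<open>con\<close> keep both coefficients of the
  polynomial in \<open>\<alpha> e\<close> nonzero. The flag \<open>\<sigma>\<close> tells how the
  smaller minor arises from the larger one: by deleting \<open>e\<close> if true, by contracting
  \<open>e\<close> if false.\<close>

locale basis_extension =
  fixes E :: "'e set" and e :: 'e and B :: "'e set set" and \<sigma> :: bool
  assumes E: "finite E" "e \<notin> E" and B: "B \<subseteq> Pow (insert e E)"
    and del: "delete_basis e B \<noteq> {}" and con: "contract_basis e B \<noteq> {}"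
begin

definition a where "a = basis_poly E (contract_basis e B)"
definition b where "b = basis_poly E (delete_basis e B)"
definition X where "X = (if \<sigma> then delete_basis e B else contract_basis e B)"
text \<open>Chosen so that, over the denominator with exponent \<open>n + 2\<close>, the integrand
  splits into the old integrand times \<open>kernel\<close> at \<open>s = n + 1\<close>.\<close>

definition numerator where
  "numerator p n = (\<lambda>\<alpha>. p \<alpha> * a \<alpha> * b \<alpha> * \<alpha> e ^ (if \<sigma> then n else 0))"

lemma numerator_rat: "p \<in> rat_poly_funs E \<Longrightarrow> numerator p n \<in> rat_poly_funs (insert e E)"
proof -
  assume p: "p \<in> rat_poly_funs E"
  have sub: "f \<in> rat_poly_funs E \<Longrightarrow> f \<in> rat_poly_funs (insert e E)" for f
    using rat_poly_funs_mono[of E "insert e E"] by blast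
  show ?thesis unfolding numerator_def
    by (rule rat_poly_funs_mult[OF rat_poly_funs_mult[OF rat_poly_funs_mult
          [OF sub[OF p] sub[of a]] sub[of b]] rat_poly_funs_power[OF rat_poly_funs_var]])
       (simp_all add: a_def b_def basis_poly_rat)
qed

lemma bases_finite: "finite (contract_basis e B)" "finite (delete_basis e B)"
proof -
  have "contract_basis e B \<subseteq> Pow E" "delete_basis e B \<subseteq> Pow E"
    using B E by (auto simp: contract_basis_def delete_basis_def)
  thus "finite (contract_basis e B)" "finite (delete_basis e B)"
    using E by (auto intro: finite_subset)
qed

lemma rat_poly_funs_upd: "p \<in> rat_poly_funs E \<Longrightarrow> p (\<alpha>(e := y)) = p \<alpha>"
  by (rule rat_poly_funs_cong[of p E]) (use E in auto)

lemma basis_poly_upd: "basis_poly (insert e E) B (\<alpha>(e := y)) = a \<alpha> + y * b \<alpha>"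
  by (simp add: basis_poly_insert[OF E B] a_def b_def rat_poly_funs_upd[OF basis_poly_rat])

lemma basis_poly_X: "basis_poly E X \<alpha> = (if \<sigma> then b \<alpha> else a \<alpha>)"
  by (simp add: X_def a_def b_def)

lemma numerator_upd:
  "p \<in> rat_poly_funs E \<Longrightarrow> numerator p n (\<alpha>(e := y)) = p \<alpha> * a \<alpha> * b \<alpha> * y ^ (if \<sigma> then n else 0)"
  by (simp add: numerator_def a_def b_def rat_poly_funs_upd basis_poly_rat)

lemma ab_pos:
  assumes "\<And>i. i \<in> E \<Longrightarrow> 0 < \<alpha> i"
  shows "0 < a \<alpha>" "0 < b \<alpha>"
  unfolding a_def b_def
  using basis_poly_pos[OF bases_finite(1) con assms] basis_poly_pos[OF bases_finite(2) del assms]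
  by simp_all

text \<open>The integrand of \<open>kernel_integral\<close>. The power of
  \<open>basis_poly E X\<close> normalizes its integral to \<open>1 / s\<close>, independently of
  \<open>\<alpha>\<close>, and cancels the denominator of the old integrand up to the exponent
  \<open>s - 1\<close>.\<close>

definition kernel where
  "kernel s \<alpha> y = y powr (of_bool \<sigma> * (s - 1)) * a \<alpha> * b \<alpha> * basis_poly E X \<alpha> powr (s - 1) / (a \<alpha> + y * b \<alpha>) powr (s + 1)"

lemma kernel_has_integral:
  assumes "\<And>i. i \<in> E \<Longrightarrow> 0 < \<alpha> i" "s > 0"
  shows "has_bochner_integral lborel (\<lambda>y. indicator {0<..} y * kernel s \<alpha> y) (1 / s)"
  unfolding kernel_def basis_poly_X by (rule kernel_integral) (use ab_pos assms in auto)

lemma kernel_nonneg: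
  assumes "\<And>i. i \<in> E \<Longrightarrow> 0 < \<alpha> i"
  shows "0 \<le> kernel s \<alpha> y"
  using ab_pos[of \<alpha>] assms by (simp add: kernel_def)

lemma periods_step:
  assumes p: "p \<in> rat_poly_funs E" and e0: "e0 \<in> E"
    and int: "hyper_integrable E e0 (\<lambda>\<alpha>. p \<alpha> / basis_poly E X \<alpha> ^ n)"
  defines "f \<equiv> \<lambda>\<alpha>. numerator p n \<alpha> / basis_poly (insert e E) B \<alpha> ^ (n + 2)"
  shows "hyper_integrable (insert e E) e0 f"
    and "hyper_integral (insert e E) e0 f = 1 / (real n + 1) * hyper_integral E e0 (\<lambda>\<alpha>. p \<alpha> / basis_poly E X \<alpha> ^ n)"
proof -
  have meas: "(\<lambda>\<alpha>. f (\<alpha>(e0 := 1))) \<in> borel_measurable (\<Pi>\<^sub>M i\<in>insert e E - {e0}. lborel)"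
    unfolding f_def
    by (intro borel_measurable_divide borel_measurable_power rat_poly_funs_measurable
        numerator_rat[OF p] basis_poly_rat)
  have ker: "\<exists>k. (\<forall>y>0. f (\<alpha>(e := y)) = p \<alpha> / basis_poly E X \<alpha> ^ n * k y \<and> 0 \<le> k y) \<and>
      has_bochner_integral lborel (\<lambda>y. indicator {0<..} y * k y) (1 / (real n + 1))"
    if \<alpha>: "\<And>i. i \<in> E \<Longrightarrow> 0 < \<alpha> i" for \<alpha>
  proof (rule exI[of _ "kernel (real n + 1) \<alpha>"], intro conjI allI impI)
    fix y :: real assume y: "y > 0"
    note ab = ab_pos[OF \<alpha>]
    have Y: "a \<alpha> + y * b \<alpha> > 0" using ab y by (simp add: add_pos_pos)
    have x: "basis_poly E X \<alpha> > 0" using ab by (simp add: basis_poly_X)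
    have "(a \<alpha> + y * b \<alpha>) powr (real n + 1 + 1) = (a \<alpha> + y * b \<alpha>) ^ (n + 2)"
      using powr_realpow[OF Y, of "n + 2"] by (simp add: algebra_simps)
    moreover have "y powr (of_bool \<sigma> * real n) = y ^ (if \<sigma> then n else 0)"
      using y by (simp add: powr_realpow)
    ultimately show "f (\<alpha>(e := y)) = p \<alpha> / basis_poly E X \<alpha> ^ n * kernel (real n + 1) \<alpha> y"
      using x by (simp add: f_def kernel_def numerator_upd[OF p] basis_poly_upd powr_realpow)
  qed (use kernel_nonneg[OF \<alpha>] kernel_has_integral[OF \<alpha>] in auto)
  show "hyper_integrable (insert e E) e0 f"
    and "hyper_integral (insert e E) e0 f = 1 / (real n + 1) * hyper_integral E e0 (\<lambda>\<alpha>. p \<alpha> / basis_poly E X \<alpha> ^ n)"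
    by (rule hyper_integral_kernel[OF E(1) e0 E(2) meas int]; use ker in blast)+
qed

text \<open>Now \<open>s = n + 1 + m * \<epsilon>\<close>. When \<open>e\<close> is deleted, the
  kernel contains \<open>y\<close> to the power \<open>n + m * \<epsilon>\<close>: the part
  \<open>n\<close> comes from the numerator, and the part \<open>m * \<epsilon>\<close> is why
  \<open>ne\<close> takes the value \<open>int m\<close> at \<open>e\<close>. When \<open>e\<close>
  is contracted, no power of \<open>y\<close> occurs.\<close>

lemma log_periods_step:
  assumes p: "p \<in> rat_poly_funs E" and e0: "e0 \<in> E"
    and int: "hyper_integrable E e0 (basis_log_integrand E X p n m ne \<epsilon>)"
    and s: "0 < real n + 1 + real m * \<epsilon>"
  defines "f \<equiv> basis_log_integrand (insert e E) B (numerator p n) (n + 2) m (ne(e := if \<sigma> then int m else 0)) \<epsilon>"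
  shows "hyper_integrable (insert e E) e0 f"
    and "hyper_integral (insert e E) e0 f =
      1 / (real n + 1 + real m * \<epsilon>) * hyper_integral E e0 (basis_log_integrand E X p n m ne \<epsilon>)"
proof -
  have meas: "(\<lambda>\<alpha>. f (\<alpha>(e0 := 1))) \<in> borel_measurable (\<Pi>\<^sub>M i\<in>insert e E - {e0}. lborel)"
    unfolding f_def by (rule basis_log_integrand_measurable[OF numerator_rat[OF p]])
  let ?s = "real n + 1 + real m * \<epsilon>"
  have ker: "\<exists>k. (\<forall>y>0. f (\<alpha>(e := y)) = basis_log_integrand E X p n m ne \<epsilon> \<alpha> * k y \<and> 0 \<le> k y) \<and>
      has_bochner_integral lborel (\<lambda>y. indicator {0<..} y * k y) (1 / ?s)"
    if \<alpha>: "\<And>i. i \<in> E \<Longrightarrow> 0 < \<alpha> i" for \<alpha>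
  proof (rule exI[of _ "kernel ?s \<alpha>"], intro conjI allI impI)
    fix y :: real assume y: "y > 0"
    note ab = ab_pos[OF \<alpha>]
    define Y where "Y = a \<alpha> + y * b \<alpha>"
    define x where "x = basis_poly E X \<alpha>"
    define W where "W = (\<Prod>i\<in>E. \<alpha> i powr (of_int (ne i) * \<epsilon>))"
    have Y: "Y > 0" using ab y by (simp add: Y_def add_pos_pos)
    have x: "x > 0" using ab by (simp add: x_def basis_poly_X)
    have Ypow: "Y powr (?s + 1) = Y ^ (n + 2) * Y powr (real m * \<epsilon>)"
    proof -
      have "?s + 1 = real (n + 2) + real m * \<epsilon>" by simp
      thus ?thesis using powr_realpow[OF Y, of "n + 2"] by (metis powr_add)
    qed
    have xpow: "x powr (?s - 1) = x ^ n * x powr (real m * \<epsilon>)"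
      using x by (simp add: powr_add powr_realpow)
    have ypow: "y powr (of_bool \<sigma> * (?s - 1)) =
        y ^ (if \<sigma> then n else 0) * y powr (of_int (if \<sigma> then int m else 0) * \<epsilon>)"
      using y by (simp add: powr_add powr_realpow)
    have W: "(\<Prod>i\<in>insert e E. (\<alpha>(e := y)) i powr (of_int ((ne(e := if \<sigma> then int m else 0)) i) * \<epsilon>)) =
        y powr (of_int (if \<sigma> then int m else 0) * \<epsilon>) * W"
    proof -
      have "(\<Prod>i\<in>E. (\<alpha>(e := y)) i powr (of_int ((ne(e := if \<sigma> then int m else 0)) i) * \<epsilon>)) = W"
        unfolding W_def by (rule prod.cong) (use E in auto)
      thus ?thesis using E by simp
    qed
    have "f (\<alpha>(e := y)) = p \<alpha> * a \<alpha> * b \<alpha> * y ^ (if \<sigma> then n else 0) / Y ^ (n + 2) *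
        (y powr (of_int (if \<sigma> then int m else 0) * \<epsilon>) * W / Y powr (real m * \<epsilon>))"
      unfolding f_def basis_log_integrand_def W numerator_upd[OF p] basis_poly_upd Y_def ..
    also have "\<dots> = p \<alpha> / x ^ n * (W / x powr (real m * \<epsilon>)) * kernel ?s \<alpha> y"
      unfolding kernel_def x_def[symmetric] Y_def[symmetric] Ypow xpow ypow using x by simp
    finally show "f (\<alpha>(e := y)) = basis_log_integrand E X p n m ne \<epsilon> \<alpha> * kernel ?s \<alpha> y"
      by (simp add: basis_log_integrand_def x_def W_def)
  qed (use kernel_nonneg[OF \<alpha>] kernel_has_integral[OF \<alpha> s] in auto)
  show "hyper_integrable (insert e E) e0 f"
    and "hyper_integral (insert e E) e0 f =
      1 / ?s * hyper_integral E e0 (basis_log_integrand E X p n m ne \<epsilon>)"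
    by (rule hyper_integral_kernel[OF E(1) e0 E(2) meas int]; use ker in blast)+
qed

lemma basis_periods_subset: "basis_periods E X \<subseteq> basis_periods (insert e E) B"
  unfolding basis_periods_def[of E]
proof (rule rat_real.span_minimal, clarify)
  fix e0 n and P :: "'e rat_mpoly"
  let ?p = "mpoly_eval P"
  assume e0: "e0 \<in> E" and P: "mpoly_vars P \<subseteq> E"
    and int: "hyper_integrable E e0 (\<lambda>\<alpha>. ?p \<alpha> / basis_poly E X \<alpha> ^ n)"
  have p: "?p \<in> rat_poly_funs E" using P by (auto simp: rat_poly_funs_def)
  obtain Q where Q: "numerator ?p n = mpoly_eval Q" "mpoly_vars Q \<subseteq> insert e E"
    using numerator_rat[OF p, of n] by (auto simp: rat_poly_funs_def)
  note step = periods_step[OF p e0 int, unfolded Q(1)]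
  let ?J = "hyper_integral (insert e E) e0 (\<lambda>\<alpha>. mpoly_eval Q \<alpha> / basis_poly (insert e E) B \<alpha> ^ (n + 2))"
  have "?J \<in> basis_periods (insert e E) B"
    unfolding basis_periods_def by (rule rat_real.span_base) (use e0 Q(2) step(1) in blast)
  hence "of_rat (of_nat (n + 1)) * ?J \<in> basis_periods (insert e E) B"
    unfolding basis_periods_def by (rule rat_real.span_scale)
  moreover have "of_rat (of_nat (n + 1)) * ?J = hyper_integral E e0 (\<lambda>\<alpha>. ?p \<alpha> / basis_poly E X \<alpha> ^ n)"
    unfolding step(2) by (simp add: of_rat_add field_simps)
  ultimately show "hyper_integral E e0 (\<lambda>\<alpha>. ?p \<alpha> / basis_poly E X \<alpha> ^ n) \<in> basis_periods (insert e E) B"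
    by simp
qed (simp add: basis_periods_def rat_real.subspace_span)

text \<open>The step divides the expansion by the series of \<open>n + 1 + m * \<epsilon>\<close>.
  Multiplying back expresses each old coefficient by at most two new ones with natural number
  factors.\<close>

lemma basis_log_periods_subset: "basis_log_periods E X \<subseteq> basis_log_periods (insert e E) B"
  unfolding basis_log_periods_def[of E]
proof (rule rat_real.span_minimal, clarify)
  fix S :: "real fps" and k e0 n m ne and P :: "'e rat_mpoly"
  let ?p = "mpoly_eval P"
  assume e0: "e0 \<in> E" and P: "mpoly_vars P \<subseteq> E"
    and int: "\<forall>\<^sub>F \<epsilon> in nhds 0. hyper_integrable E e0 (basis_log_integrand E X ?p n m ne \<epsilon>)"
    and S: "(\<lambda>\<epsilon>. hyper_integral E e0 (basis_log_integrand E X ?p n m ne \<epsilon>)) has_fps_expansion S"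
  have p: "?p \<in> rat_poly_funs E" using P by (auto simp: rat_poly_funs_def)
  obtain Q where Q: "numerator ?p n = mpoly_eval Q" "mpoly_vars Q \<subseteq> insert e E"
    using numerator_rat[OF p, of n] by (auto simp: rat_poly_funs_def)
  note step = log_periods_step[where n = n, OF p e0, unfolded Q(1)]
  let ?f = "basis_log_integrand (insert e E) B (mpoly_eval Q) (n + 2) m (ne(e := if \<sigma> then int m else 0))"
  \<comment> \<open>The power series of \<open>s\<close>; it is invertible because its constant term
    is \<open>n + 1\<close>.\<close>
  define L :: "real fps" where "L = fps_const (real n + 1) + fps_const (real m) * fps_X"
  have L0: "fps_nth L 0 \<noteq> 0" by (simp add: L_def)
  have L: "(\<lambda>\<epsilon>. real n + 1 + real m * \<epsilon>) has_fps_expansion L"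
    unfolding L_def by (intro fps_expansion_intros)
  \<comment> \<open>The kernel requires \<open>s > 0\<close>, which holds only near
    \<open>\<epsilon> = 0\<close> in general; that suffices for a Taylor expansion.\<close>
  have "((\<lambda>\<epsilon>. real n + 1 + real m * \<epsilon>) \<longlongrightarrow> real n + 1 + real m * 0) (nhds 0)"
    by (intro tendsto_intros filterlim_ident)
  hence pos: "\<forall>\<^sub>F \<epsilon> in nhds 0. 0 < real n + 1 + real m * \<epsilon>"
    by (rule order_tendstoD) simp
  have int': "\<forall>\<^sub>F \<epsilon> in nhds 0. hyper_integrable (insert e E) e0 (?f \<epsilon>)"
    using int pos by eventually_elim (rule step(1))
  have eq: "\<forall>\<^sub>F \<epsilon> in nhds 0. hyper_integral E e0 (basis_log_integrand E X ?p n m ne \<epsilon>) * inverse (real n + 1 + real m * \<epsilon>) =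
      hyper_integral (insert e E) e0 (?f \<epsilon>)"
    using int pos
  proof eventually_elim
    case (elim \<epsilon>)
    show ?case using step(2)[OF elim]
      by (simp only: divide_inverse mult_1_left mult.commute)
  qed
  define S' where "S' = S * inverse L"
  have S': "(\<lambda>\<epsilon>. hyper_integral E e0 (basis_log_integrand E X ?p n m ne \<epsilon>) *
      inverse (real n + 1 + real m * \<epsilon>)) has_fps_expansion S'"
    unfolding S'_def by (rule has_fps_expansion_mult[OF S has_fps_expansion_inverse[OF L L0]])
  hence "\<forall>\<^sub>F \<epsilon> in nhds 0. eval_fps S' \<epsilon> =
      hyper_integral E e0 (basis_log_integrand E X ?p n m ne \<epsilon>) * inverse (real n + 1 + real m * \<epsilon>)"
    unfolding has_fps_expansion_def by (rule conjunct2)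
  with eq have "\<forall>\<^sub>F \<epsilon> in nhds 0. eval_fps S' \<epsilon> = hyper_integral (insert e E) e0 (?f \<epsilon>)"
    by eventually_elim (rule trans)
  hence exp: "(\<lambda>\<epsilon>. hyper_integral (insert e E) e0 (?f \<epsilon>)) has_fps_expansion S'"
    using S' unfolding has_fps_expansion_def by blast
  have mem: "fps_nth S' j \<in> basis_log_periods (insert e E) B" for j
    unfolding basis_log_periods_def
    by (rule rat_real.span_base, rule CollectI, rule exI[of _ S'], rule exI[of _ j], rule exI[of _ e0],
        rule exI[of _ "n + 2"], rule exI[of _ m], rule exI[of _ "ne(e := if \<sigma> then int m else 0)"],
        rule exI[of _ Q]) (intro conjI refl insertI2 e0 Q(2) int' exp)
  have "S = S' * L"
    by (simp only: S'_def mult.assoc inverse_mult_eq_1[OF L0] mult_1_right)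
  also have "\<dots> = fps_const (real n + 1) * S' + fps_const (real m) * (fps_X * S')"
    unfolding L_def by (simp only: distrib_left mult_ac)
  finally have "fps_nth S k = fps_nth (fps_const (real n + 1) * S' + fps_const (real m) * (fps_X * S')) k"
    by simp
  \<comment> \<open>Multiplication by \<open>fps_X\<close> shifts the coefficients by one, so
    nothing is contributed at \<open>k = 0\<close>.\<close>
  also have "\<dots> = of_rat (of_nat (n + 1)) * fps_nth S' k +
      of_rat (of_nat m) * (if k = 0 then 0 else fps_nth S' (k - 1))"
    by (simp add: of_rat_add add.commute del: fps_const_add)
  also have "\<dots> \<in> basis_log_periods (insert e E) B"
    using mem unfolding basis_log_periods_def
    by (intro rat_real.span_add rat_real.span_scale) (auto simp: rat_real.span_zero)
  finally show "fps_nth S k \<in> basis_log_periods (insert e E) B" .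
qed (simp add: basis_log_periods_def rat_real.subspace_span)

end

section \<open>Minor monotonicity\<close>

lemma graph_poly_eq: "graph_poly G = basis_poly (edges G) (spanning_trees G)"
  by (simp add: graph_poly_def basis_poly_def fun_eq_iff)

lemma real_periods_eq: "real_periods G = basis_periods (edges G) (spanning_trees G)"
  unfolding real_periods_def basis_periods_def graph_integral_def hyper_integral_def
    abs_convergent_def hyper_integrable_def orthant_def graph_poly_eq ..

lemma real_log_periods_eq: "real_log_periods G = basis_log_periods (edges G) (spanning_trees G)"
proof -
  have "log_integrand G P n m ne = basis_log_integrand (edges G) (spanning_trees G) (mpoly_eval P) n m ne"
    for P n m ne
    by (simp add: fun_eq_iff log_integrand_def basis_log_integrand_def graph_poly_eq)
  thus ?thesis
    unfolding real_log_periods_def basis_log_periods_def graph_integral_def hyper_integral_def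
      abs_convergent_def hyper_integrable_def orthant_def by simp
qed

text \<open>Induction on the number of edges still missing from \<open>F\<close>; the exchange lemma
  supplies the next edge and the locale the inclusion for it.\<close>

lemma minor_trees_periods_subset:
  assumes G: "multigraph G" "nonseparable G" "verts G \<noteq> {}"
    and "F \<subseteq> edges G" "F \<noteq> {}" "C \<subseteq> edges G - F" "minor_trees G C F \<noteq> {}"
  shows "basis_periods F (minor_trees G C F) \<subseteq> real_periods G \<and>
    basis_log_periods F (minor_trees G C F) \<subseteq> real_log_periods G"
  using assms(4-)
proof (induction "card (edges G - F)" arbitrary: F C rule: less_induct)
  case less
  have finG: "finite (edges G)" using G(1) by (simp add: multigraph_def)
  show ?case
  proof (cases "F = edges G")
    case True
    \<comment> \<open>No edges remain outside \<open>F\<close>, so \<open>C\<close> is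
      empty.\<close>
    hence "minor_trees G C F = spanning_trees G"
      using less.prems by (auto simp: minor_trees_def spanning_trees_def)
    thus ?thesis using True by (simp add: real_periods_eq real_log_periods_eq)
  next
    case False
    hence F: "F \<subset> edges G" using less.prems by blast
    obtain e where e: "e \<in> edges G - F" "minor_trees G (C - {e}) F \<noteq> {}" "minor_trees G (insert e C) F \<noteq> {}"
      using minor_trees_exchange[OF G F less.prems(2-4)] by blast
    \<comment> \<open>The next larger minor: \<open>e\<close> is restored as an edge, so it is no
      longer contracted.\<close>
    define B where "B = minor_trees G (C - {e}) (insert e F)"
    have delete: "delete_basis e B = minor_trees G (C - {e}) F"
      using e(1) by (auto simp: delete_basis_def B_def minor_trees_def)
    have "insert e T \<union> (C - {e}) = T \<union> insert e C" for T by blast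
    hence contract: "contract_basis e B = minor_trees G (insert e C) F"
      using e(1) by (auto simp: contract_basis_def B_def minor_trees_def)
    \<comment> \<open>The flag records the present role of \<open>e\<close>: if \<open>e\<close> is
      not in \<open>C\<close>, the current minor is the deletion of \<open>e\<close>, otherwise the
      contraction. Hence \<open>X\<close> is the family of the current minor.\<close>
    interpret basis_extension F e B "e \<notin> C"
    proof
      show "finite F" using finG less.prems(1) by (rule rev_finite_subset)
      show "B \<subseteq> Pow (insert e F)" by (auto simp: B_def minor_trees_def)
    qed (use e delete contract in auto)
    have X: "X = minor_trees G C F" by (simp add: X_def delete contract insert_absorb)
    have "edges G - insert e F \<subset> edges G - F" using e(1) by blast
    hence "card (edges G - insert e F) < card (edges G - F)" using finG by (simp add: psubset_card_mono)
    moreover have "insert e F \<subseteq> edges G" "C - {e} \<subseteq> edges G - insert e F"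
      using e(1) less.prems by blast+
    moreover have "B \<noteq> {}" using delete e(2) by (auto simp: delete_basis_def)
    ultimately have "basis_periods (insert e F) B \<subseteq> real_periods G \<and>
        basis_log_periods (insert e F) B \<subseteq> real_log_periods G"
      unfolding B_def using less.hyps[of "insert e F" "C - {e}"] by blast
    thus ?thesis using basis_periods_subset basis_log_periods_subset unfolding X by blast
  qed
qed

theorem proposition37:
  fixes G :: "('v, 'e) mgraph" and \<gamma> :: "('v set, 'e) mgraph"
  assumes "multigraph G" and "connected_graph G" and "nonseparable G"
    and "is_minor \<gamma> G" and "verts \<gamma> \<noteq> {}" and "connected_graph \<gamma>"
  shows "real_periods \<gamma> \<subseteq> real_periods G \<and> real_log_periods \<gamma> \<subseteq> real_log_periods G"
proof -
  have G: "multigraph G" "nonseparable G" "verts G \<noteq> {}"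
    using assms is_minor_trees(1)[of G \<gamma>] by blast+
  obtain C where C: "C \<subseteq> edges G - edges \<gamma>" "edges \<gamma> \<subseteq> edges G"
    "spanning_trees \<gamma> = minor_trees G C (edges \<gamma>)" "minor_trees G C (edges \<gamma>) \<noteq> {}"
    using is_minor_trees(2)[OF assms(1,4,5,6)] by blast
  show ?thesis
  proof (cases "edges \<gamma> = {}")
    case True
    \<comment> \<open>Without an edge to set to \<open>1\<close> there are no generating integrals,
      so both spaces of the minor are zero.\<close>
    thus ?thesis
      by (simp add: real_periods_def real_log_periods_def rat_real.span_zero)
  next
    case False
    from minor_trees_periods_subset[OF G C(2) this C(1,4)] show ?thesis
      unfolding real_periods_eq[of \<gamma>] real_log_periods_eq[of \<gamma>] C(3) .
  qed
qed

end
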